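(* Let $A\in\mathbb{R}^{n\times n}$ be invertible and let $L=\sum_{j=0}^DA^{D-j}B_j$. The following statements are equivalent. a) The system $x_{t+1}=Ax_t+\sum_{\tau=0}^D (B_\tau+\omega_t^\tau C_\tau)u_{t-\tau}$, $t\ge0$, is asymptotically mean-square stabilizable. b) The delay-free system $$\beta_{t+1}=A\beta_t+Lv_t+\sum_{\tau=0}^D\omega_t^\tau A^DC_\tau v_t,\qquad \beta_t\in\mathbb{R}^n,\ v_t\in\mathbb{R}^m,$$ is asymptotically mean-square stabilizable with $v_t=K\beta_t$, i.e. there is a constant matrix $K\in\mathbb{R}^{m\times n}$ such that the closed-loop system $\beta_{t+1}=(A+LK)\beta_t+\sum_{\tau=0}^D\omega_t^\tau A^DC_\tau K\beta_t$ satisfies $\lim_{t\to\infty}\mathbf{E}(\beta_t'\beta_t)=0$ for every initial value $\beta_0$. c) For any $Q>0$, there exist matrices $K$ and $P>0$ satisfying the delay-dependent Lyapunov equation $$P=Q+(A+LK)'P(A+LK)+\sum_{\tau=0}^D\sigma_\tau^2K'C_\tau'(A')^DPA^DC_\tau K.$$ d) There exist matrices $K$ and $P>0$ satisfying the delay-dependent Lyapunov inequality $$P>(A+LK)'P(A+LK)+\sum_{\tau=0}^D\sigma_\tau^2K'C_\tau'(A')^DPA^DC_\tau K.$$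
   Context: Primes denote transposes and $\mathbf{E}$ denotes expectation; $P>0$ means $P$ is symmetric positive definite, and $P>M$ means $P-M>0$. $D\ge 0$ is an integer (empty sums are zero), $x_t\in\mathbb{R}^n$ is the state, $u_t\in\mathbb{R}^m$ is the control input, and $A\in\mathbb{R}^{n\times n}$, $B_\tau,C_\tau\in\mathbb{R}^{n\times m}$ ($\tau=0,\dots,D$) are constant. The initial data $x_0$ and $u_t$, $t=-D,\dots,-1$, are given a priori (deterministic). Noise: $\{\omega_t^\tau\}_{t\ge0}$, $\tau=0,\dots,D$, are real random sequences, independent and identically distributed in time for each $\tau$ and mutually independent for different $\tau$, with $\mathbf{E}(\omega_t^\tau)=0$ and $\mathbf{E}(\omega_t^\tau\omega_s^\tau)=\sigma_\tau^2\delta_{ts}$ ($\delta_{ts}$ the Kronecker delta). Put $\omega_t=(\omega_t^0,\dots,\omega_t^D)'$ and $\mathcal{F}_t=\sigma\{\omega_s: 0\le s\le t\}$. Admissible controls: $\mathcal{U}_{ad}$ is the set of control processes $u$ such that $u_t$ is $\mathcal{F}_t$-measurable, $\sum_{t=0}^\infty\mathbf{E}(u_t'u_t)<\infty$, and $u_t=K_0x_t+\sum_{\tau=1}^DK_\tau u_{t-\tau}$ for all $t\ge 0$, for some constant matrices $K_0,\dots,K_D$ of compatible dimensions. (Such $u_t$ is then in fact $\mathcal{F}_{t-1}$-measurable.) Stabilizability in a): the system for $x_t$ is asymptotically mean-square stabilizable if there exists a feedback control law (constant gains $K_0,\dots,K_D$) in $\mathcal{U}_{ad}$ such that the closed-loop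 system satisfies $\lim_{t\to\infty}\mathbf{E}(x_t'x_t)=0$ for any initial values $x_0$ and $u_t$, $t=-D,\dots,-1$. *)

theory Defs
  imports "HOL-Probability.Probability"
begin

(* The class instance "^" on real^'n^'n is the entrywise power, hence a separate definition. *)
primrec matpow :: "real^'n^'n \<Rightarrow> nat \<Rightarrow> real^'n^'n" where
  "matpow A 0 = mat 1"
| "matpow A (Suc k) = A ** matpow A k"

definition posdef :: "real^'n^'n \<Rightarrow> bool" where
  "posdef P \<longleftrightarrow> transpose P = P \<and> (\<forall>v. v \<noteq> 0 \<longrightarrow> 0 < v \<bullet> (P *v v))"

(* \<omega> \<tau> t is the noise of channel \<tau> at time t; only the channels \<tau> \<le> D matter.
   Square integrability is stated separately because the Bochner integral of a
   non-integrable function is 0. *)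
locale delay_noise = prob_space M
  for M :: "'w measure" and D :: nat and \<omega> :: "nat \<Rightarrow> nat \<Rightarrow> 'w \<Rightarrow> real" and \<sigma> :: "nat \<Rightarrow> real" +
  assumes independent_in_time: "\<And>\<tau>. \<tau> \<le> D \<Longrightarrow> indep_vars (\<lambda>_. borel) (\<omega> \<tau>) UNIV"
    and identically_distributed:
      "\<And>\<tau> t s. \<tau> \<le> D \<Longrightarrow> distr M borel (\<omega> \<tau> t) = distr M borel (\<omega> \<tau> s)"
    and independent_channels:
      "indep_vars (\<lambda>_. Pi\<^sub>M UNIV (\<lambda>_::nat. borel)) (\<lambda>\<tau> w t. \<omega> \<tau> t w) {..D}"
    and square_integrable: "\<And>\<tau> t. \<tau> \<le> D \<Longrightarrow> integrable M (\<lambda>w. (\<omega> \<tau> t w)\<^sup>2)"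
    and mean_zero: "\<And>\<tau> t. \<tau> \<le> D \<Longrightarrow> expectation (\<omega> \<tau> t) = 0"
    and covariance: "\<And>\<tau> t s. \<tau> \<le> D \<Longrightarrow>
      expectation (\<lambda>w. \<omega> \<tau> t w * \<omega> \<tau> s w) = (if t = s then (\<sigma> \<tau>)\<^sup>2 else 0)"

(* The sigma-algebra generated by the random vectors (\<omega> 0 s, ..., \<omega> D s), s \<le> t. *)
definition noise_filtration ::
  "'w measure \<Rightarrow> nat \<Rightarrow> (nat \<Rightarrow> nat \<Rightarrow> 'w \<Rightarrow> real) \<Rightarrow> nat \<Rightarrow> 'w measure" where
  "noise_filtration M D \<omega> t =
     sigma (space M) {\<omega> \<tau> s -` S \<inter> space M |\<tau> s S. \<tau> \<le> D \<and> s \<le> t \<and> S \<in> sets borel}"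

(* Controls are indexed by int so that u (-D), ..., u (-1) carry the initial data. *)
definition delayed_system ::
  "'w measure \<Rightarrow> nat \<Rightarrow> (nat \<Rightarrow> nat \<Rightarrow> 'w \<Rightarrow> real) \<Rightarrow>
   real^'n^'n \<Rightarrow> (nat \<Rightarrow> real^'m^'n) \<Rightarrow> (nat \<Rightarrow> real^'m^'n) \<Rightarrow>
   (nat \<Rightarrow> 'w \<Rightarrow> real^'n) \<Rightarrow> (int \<Rightarrow> 'w \<Rightarrow> real^'m) \<Rightarrow> bool" where
  "delayed_system M D \<omega> A B C x u \<longleftrightarrow>
     (\<forall>t. \<forall>w\<in>space M. x (Suc t) w =
        A *v x t w + (\<Sum>\<tau>\<le>D. (B \<tau> + \<omega> \<tau> t w *\<^sub>R C \<tau>) *v u (int t - int \<tau>) w))"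

definition initial_data ::
  "'w measure \<Rightarrow> nat \<Rightarrow> real^'n \<Rightarrow> (int \<Rightarrow> real^'m) \<Rightarrow>
   (nat \<Rightarrow> 'w \<Rightarrow> real^'n) \<Rightarrow> (int \<Rightarrow> 'w \<Rightarrow> real^'m) \<Rightarrow> bool" where
  "initial_data M D x0 u0 x u \<longleftrightarrow>
     (\<forall>w\<in>space M. x 0 w = x0 \<and> (\<forall>s\<in>{- int D..-1}. u s w = u0 s))"

definition feedback_law ::
  "'w measure \<Rightarrow> nat \<Rightarrow> real^'n^'m \<Rightarrow> (nat \<Rightarrow> real^'m^'m) \<Rightarrow>
   (nat \<Rightarrow> 'w \<Rightarrow> real^'n) \<Rightarrow> (int \<Rightarrow> 'w \<Rightarrow> real^'m) \<Rightarrow> bool" where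
  "feedback_law M D K0 K x u \<longleftrightarrow>
     (\<forall>t::nat. \<forall>w\<in>space M. u (int t) w =
        K0 *v x t w + (\<Sum>\<tau>=1..D. K \<tau> *v u (int t - int \<tau>) w))"

definition admissible ::
  "'w measure \<Rightarrow> nat \<Rightarrow> (nat \<Rightarrow> nat \<Rightarrow> 'w \<Rightarrow> real) \<Rightarrow>
   (nat \<Rightarrow> 'w \<Rightarrow> real^'n) \<Rightarrow> (int \<Rightarrow> 'w \<Rightarrow> real^'m) \<Rightarrow> bool" where
  "admissible M D \<omega> x u \<longleftrightarrow>
     (\<forall>t::nat. u (int t) \<in> noise_filtration M D \<omega> t \<rightarrow>\<^sub>M borel) \<and>
     (\<forall>t::nat. integrable M (\<lambda>w. u (int t) w \<bullet> u (int t) w)) \<and>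
     summable (\<lambda>t::nat. integral\<^sup>L M (\<lambda>w. u (int t) w \<bullet> u (int t) w)) \<and>
     (\<exists>K0 K. feedback_law M D K0 K x u)"

definition mean_square_to_zero ::
  "'w measure \<Rightarrow> (nat \<Rightarrow> 'w \<Rightarrow> real^'n) \<Rightarrow> bool" where
  "mean_square_to_zero M x \<longleftrightarrow>
     (\<forall>t. integrable M (\<lambda>w. x t w \<bullet> x t w)) \<and>
     (\<lambda>t. integral\<^sup>L M (\<lambda>w. x t w \<bullet> x t w)) \<longlonglongrightarrow> 0"

(* The closed loop determines x and u on space M uniquely from the initial data, so quantifying
   over all its trajectories only names that one; closed_loop_exists rules out vacuity. *)
definition ms_stabilizable ::
  "'w measure \<Rightarrow> nat \<Rightarrow> (nat \<Rightarrow> nat \<Rightarrow> 'w \<Rightarrow> real) \<Rightarrow>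
   real^'n^'n \<Rightarrow> (nat \<Rightarrow> real^'m^'n) \<Rightarrow> (nat \<Rightarrow> real^'m^'n) \<Rightarrow> bool" where
  "ms_stabilizable M D \<omega> A B C \<longleftrightarrow>
     (\<exists>K0 K. \<forall>x0 u0 x u.
        initial_data M D x0 u0 x u \<and> delayed_system M D \<omega> A B C x u \<and> feedback_law M D K0 K x u
        \<longrightarrow> admissible M D \<omega> x u \<and> mean_square_to_zero M x)"

definition delay_free_closed_loop ::
  "'w measure \<Rightarrow> nat \<Rightarrow> (nat \<Rightarrow> nat \<Rightarrow> 'w \<Rightarrow> real) \<Rightarrow>
   real^'n^'n \<Rightarrow> real^'m^'n \<Rightarrow> (nat \<Rightarrow> real^'m^'n) \<Rightarrow> real^'n^'m \<Rightarrow>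
   (nat \<Rightarrow> 'w \<Rightarrow> real^'n) \<Rightarrow> bool" where
  "delay_free_closed_loop M D \<omega> A L C K \<beta> \<longleftrightarrow>
     (\<forall>t. \<forall>w\<in>space M. \<beta> (Suc t) w =
        (A + L ** K) *v \<beta> t w
        + (\<Sum>\<tau>\<le>D. \<omega> \<tau> t w *\<^sub>R ((matpow A D ** C \<tau> ** K) *v \<beta> t w)))"

definition delay_free_ms_stabilizable ::
  "'w measure \<Rightarrow> nat \<Rightarrow> (nat \<Rightarrow> nat \<Rightarrow> 'w \<Rightarrow> real) \<Rightarrow>
   real^'n^'n \<Rightarrow> real^'m^'n \<Rightarrow> (nat \<Rightarrow> real^'m^'n) \<Rightarrow> bool" where
  "delay_free_ms_stabilizable M D \<omega> A L C \<longleftrightarrow>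
     (\<exists>K. \<forall>\<beta>0 \<beta>. (\<forall>w\<in>space M. \<beta> 0 w = \<beta>0) \<and> delay_free_closed_loop M D \<omega> A L C K \<beta>
        \<longrightarrow> mean_square_to_zero M \<beta>)"

definition lyapunov_rhs ::
  "nat \<Rightarrow> (nat \<Rightarrow> real) \<Rightarrow> real^'n^'n \<Rightarrow> real^'m^'n \<Rightarrow> (nat \<Rightarrow> real^'m^'n) \<Rightarrow>
   real^'n^'m \<Rightarrow> real^'n^'n \<Rightarrow> real^'n^'n" where
  "lyapunov_rhs D \<sigma> A L C K P =
     transpose (A + L ** K) ** P ** (A + L ** K)
     + (\<Sum>\<tau>\<le>D. (\<sigma> \<tau>)\<^sup>2 *\<^sub>R
          (transpose K ** transpose (C \<tau>) ** matpow (transpose A) D ** P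
            ** matpow A D ** C \<tau> ** K))"

lemma closed_loop_exists:
  fixes A :: "real^'n^'n" and B C :: "nat \<Rightarrow> real^'m^'n"
    and K0 :: "real^'n^'m" and K :: "nat \<Rightarrow> real^'m^'m"
  shows "\<exists>x u. initial_data M D x0 u0 x u \<and> delayed_system M D \<omega> A B C x u
           \<and> feedback_law M D K0 K x u"
proof -
  define ctl :: "(real^'n) \<times> (nat \<Rightarrow> real^'m) \<Rightarrow> real^'m"
    where "ctl z = K0 *v fst z + (\<Sum>\<tau>=1..D. K \<tau> *v snd z \<tau>)" for z
  define hist :: "(real^'n) \<times> (nat \<Rightarrow> real^'m) \<Rightarrow> nat \<Rightarrow> real^'m"
    where "hist z \<tau> = (if \<tau> = 0 then ctl z else snd z \<tau>)" for z \<tau>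
  define z where "z t w = rec_nat (x0, \<lambda>\<tau>. u0 (- int \<tau>))
     (\<lambda>t z. (A *v fst z + (\<Sum>\<tau>\<le>D. (B \<tau> + \<omega> \<tau> t w *\<^sub>R C \<tau>) *v hist z \<tau>),
            \<lambda>\<tau>. hist z (\<tau> - 1))) t" for t w
  define x where "x t w = fst (z t w)" for t w
  define u where "u s w = (if s < 0 then u0 s else ctl (z (nat s) w))" for s w
  have z0: "z 0 w = (x0, \<lambda>\<tau>. u0 (- int \<tau>))" for w
    by (simp add: z_def)
  have zS: "z (Suc t) w =
      (A *v fst (z t w) + (\<Sum>\<tau>\<le>D. (B \<tau> + \<omega> \<tau> t w *\<^sub>R C \<tau>) *v hist (z t w) \<tau>),
       \<lambda>\<tau>. hist (z t w) (\<tau> - 1))" for t w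
    by (simp add: z_def)
  have h: "hist (z t w) \<tau> = u (int t - int \<tau>) w" for t w \<tau>
  proof (induction t arbitrary: \<tau>)
    case 0
    then show ?case by (simp add: hist_def u_def z0)
  next
    case (Suc t)
    show ?case
    proof (cases \<tau>)
      case 0
      then show ?thesis by (simp add: hist_def u_def nat_add_distrib)
    next
      case (Suc k)
      then have "hist (z (Suc t) w) \<tau> = hist (z t w) k"
        by (subst hist_def) (simp add: zS)
      then show ?thesis using Suc.IH Suc by simp
    qed
  qed
  have "initial_data M D x0 u0 x u"
    by (simp add: initial_data_def x_def u_def z0)
  moreover have "delayed_system M D \<omega> A B C x u"
    by (simp add: delayed_system_def x_def zS h)
  moreover have "feedback_law M D K0 K x u"
  proof -
    have "snd (z t w) \<tau> = u (int t - int \<tau>) w" if "\<tau> \<ge> 1" for t w \<tau>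
      using h[of t w \<tau>] that by (simp add: hist_def)
    then show ?thesis
      by (simp add: feedback_law_def u_def[of "int _"] ctl_def x_def)
  qed
  ultimately show ?thesis by blast
qed

end

theory Submission
  imports Defs
begin

text \<open>The delays in the drift can be removed exactly. Let \<open>\<beta> t\<close> be the prediction of the state \<open>D\<close> steps
  ahead when no further control is applied, that is, \<open>A^D x t\<close> plus a fixed linear combination of the
  controls at times \<open>t - 1, ..., t - D\<close>. The sum telescopes and \<open>\<beta>\<close> satisfies
  \<open>\<beta> (t + 1) = A \<beta> t + L u t + (\<Sum>\<tau>\<le>D. \<omega> \<tau> t A^D C \<tau> u (t - \<tau>))\<close>,
  so that delays survive in the noise terms only (\<open>predictor_step\<close>). A second moment does not see at which
  of the past times the factor multiplying a fresh noise was produced, except through its size; summed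
  over time, a delay only shifts a nonnegative series. Hence delayed noise and undelayed noise
  lead to the same Lyapunov inequality. To exploit this, the delay in channel \<open>\<tau>\<close> is an arbitrary
  \<open>d \<tau> \<le> D\<close> below: the choice \<open>d \<tau> = \<tau>\<close> gives the predictor of the delayed system, and \<open>d \<tau> = 0\<close> gives
  the delay-free system, and both satisfy the same two theorems.

  Sufficiency of the Lyapunov inequality (\<open>summable_reduced_trajectory\<close>). With \<open>u t = K \<beta> t\<close>, the
  functional \<open>E (\<beta>' P \<beta>)\<close> plus the weighted second moments of the controls that still wait to enter through
  a noise term decreases by \<open>E (\<beta>' H \<beta>)\<close> in each step, where \<open>H > 0\<close> is the slack of the inequality. So
  \<open>E (\<beta>' \<beta>)\<close> is summable, and \<open>u\<close> and, as \<open>A\<close> is invertible, \<open>x\<close> inherit the decay.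

  Necessity (\<open>reduced_null_imp_lyapunov\<close>). A stabilizing law may feed back the past controls, so it
  does not come with a gain \<open>K\<close> for \<open>\<beta>\<close>. The gain is obtained by linear regression: start the predictor at
  each basis vector, let \<open>X, Y, U\<close> be the second moments of \<open>(\<beta>, u)\<close> summed over these starts and
  over \<open>N\<close> steps, and put \<open>K = Y X^{-1}\<close>. The residual \<open>u - K \<beta>\<close> is uncorrelated with \<open>\<beta>\<close> and only adds to
  the second moments (\<open>schur_complement\<close>), so the summed moment equation gives
  \<open>X \<ge> I / 2 + (A + L K) X (A + L K)' + (\<Sum>\<tau>\<le>D. \<sigma> \<tau> ^ 2 (A^D C \<tau> K) X (A^D C \<tau> K)')\<close>.
  The initial values contribute \<open>I\<close>; the boundary terms at time \<open>N\<close> vanish in the limit by stability, and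
  for large \<open>N\<close> they cost at most \<open>I / 2\<close>. This is the Lyapunov inequality for the adjoint operator, and
  trace duality turns it into the inequality for \<open>P\<close> (\<open>dual_lyapunov_inequality\<close>).

  Finally, let \<open>T P\<close> be the right-hand side of the inequality. A solution of \<open>P > T P\<close> majorizes, after scaling,
  the increasing iterates of \<open>P \<mapsto> Q + T P\<close>, whose limit solves the equation for any \<open>Q\<close> (\<open>lyapunov_equation_solvable\<close>).\<close>

section \<open>Matrices and quadratic forms\<close>

text \<open>Adjoint gains have to stay visible as transposes.\<close>

declare transpose_matrix_vector [simp del]

lemma matpow_comm: "matpow A k ** A = A ** matpow A k"
  by (induction k) (simp_all add: matrix_mul_assoc[symmetric])

lemma transpose_matpow: "transpose (matpow A k) = matpow (transpose A) k"
  by (induction k) (simp_all add: matrix_transpose_mul matpow_comm)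

lemma invertible_matpow: "invertible A \<Longrightarrow> invertible (matpow A k)"
  by (induction k) (simp_all add: invertible_mult invertible_def[of "mat 1"] exI[of _ "mat 1"])

lemma sum_matrix_vector_mult: "(\<Sum>i\<in>I. F i) *v v = (\<Sum>i\<in>I. F i *v v)"
  for F :: "'i \<Rightarrow> real^'b^'a"
  by (induction I rule: infinite_finite_induct) (simp_all add: matrix_vector_mult_add_rdistrib)

lemma matrix_add_rdistrib: "(M + N) ** G = M ** G + N ** (G::real^'c^'b)"
  by (simp add: matrix_matrix_mult_def vec_eq_iff sum.distrib algebra_simps)

lemma scaleR_matrix_mult_left: "(c *\<^sub>R M) ** G = c *\<^sub>R (M ** (G::real^'c^'b))"
  by (simp add: matrix_matrix_mult_def vec_eq_iff sum_distrib_left mult_ac)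

lemma scaleR_matrix_mult_right: "M ** (c *\<^sub>R G) = c *\<^sub>R (M ** (G::real^'c^'b))"
  by (simp add: matrix_matrix_mult_def vec_eq_iff sum_distrib_left mult_ac)

lemma matrix_vector_mult_sum_right: "(G::real^'b^'a) *v (\<Sum>i\<in>I. f i) = (\<Sum>i\<in>I. G *v f i)"
  by (rule linear_sum[OF matrix_vector_mul_linear])

lemma matrix_mult_sum_right: "(M::real^'b^'a) ** (\<Sum>i\<in>I. F i) = (\<Sum>i\<in>I. M ** F i)"
  by (induction I rule: infinite_finite_induct) (simp_all add: matrix_add_ldistrib)

lemma inner_transpose_mult: "(v::real^'a) \<bullet> (transpose G *v w) = (G *v v) \<bullet> (w::real^'b)"
  by (metis dot_lmul_matrix transpose_matrix_vector inner_commute)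

lemma inner_mult_eq_transpose: "(v::real^'a) \<bullet> (G *v w) = (transpose G *v v) \<bullet> (w::real^'b)"
  by (metis inner_transpose_mult transpose_transpose)

lemma transpose_sum: "transpose (\<Sum>i\<in>I. F i) = (\<Sum>i\<in>I. transpose (F i :: real^'b^'a))"
  by (simp add: transpose_def vec_eq_iff)

lemma transpose_scaleR: "transpose (c *\<^sub>R M) = c *\<^sub>R transpose (M :: real^'b^'a)"
  by (simp add: transpose_def vec_eq_iff)

lemma transpose_add: "transpose (M + N) = transpose M + transpose (N :: real^'b^'a)"
  by (simp add: transpose_def vec_eq_iff)

lemma transpose_diff: "transpose (M - N) = transpose M - transpose (N :: real^'b^'a)"
  by (simp add: transpose_def vec_eq_iff)

lemma matrix_vector_mult_norm_bound:
  fixes M :: "real^'b^'a"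
  obtains c where "c > 0" "\<And>v. norm (M *v v) \<le> c * norm v"
proof -
  obtain c where "c > 0" "\<And>v. norm (M *v v) \<le> norm v * c"
    using bounded_linear.pos_bounded[OF matrix_vector_mul_bounded_linear[of M]] by blast
  then show ?thesis using that[of c] by (simp add: mult.commute)
qed

lemma matrix_vector_mult_inner_bound:
  fixes M :: "real^'b^'a"
  obtains c where "c > 0" "\<And>v. (M *v v) \<bullet> (M *v v) \<le> c * (v \<bullet> v)"
proof -
  obtain c where c: "c > 0" "\<And>v. norm (M *v v) \<le> c * norm v"
    by (rule matrix_vector_mult_norm_bound[of M]) blast
  have "(M *v v) \<bullet> (M *v v) \<le> c\<^sup>2 * (v \<bullet> v)" for v
    using power_mono[OF c(2)[of v], of 2] by (simp add: power_mult_distrib power2_norm_eq_inner)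
  then show ?thesis using that[of "c\<^sup>2"] c(1) by simp
qed

lemma quadratic_form_le:
  fixes P :: "real^'n^'n"
  obtains c where "c > 0" "\<And>v. v \<bullet> (P *v v) \<le> c * (v \<bullet> v)"
proof -
  obtain c where c: "c > 0" "\<And>v. norm (P *v v) \<le> c * norm v"
    by (rule matrix_vector_mult_norm_bound[of P]) blast
  have "v \<bullet> (P *v v) \<le> c * (v \<bullet> v)" for v
  proof -
    have "v \<bullet> (P *v v) \<le> norm v * norm (P *v v)" by (rule norm_cauchy_schwarz)
    also have "\<dots> \<le> norm v * (c * norm v)" by (intro mult_left_mono c) auto
    finally show ?thesis by (simp add: dot_square_norm power2_eq_square algebra_simps)
  qed
  then show ?thesis using that c(1) by blast
qed

lemma posdef_ge:
  fixes P :: "real^'n^'n"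
  assumes "posdef P"
  obtains c where "c > 0" "\<And>v. c * (v \<bullet> v) \<le> v \<bullet> (P *v v)"
proof -
  let ?S = "sphere (0::real^'n) 1"
  have cont: "continuous_on ?S (\<lambda>v. v \<bullet> (P *v v))"
    by (intro continuous_intros linear_continuous_on matrix_vector_mul_bounded_linear)
  have "axis undefined 1 \<in> ?S" by (simp add: norm_axis_1)
  then have "?S \<noteq> {}" by blast
  then obtain z where z: "z \<in> ?S" "\<And>v. v \<in> ?S \<Longrightarrow> z \<bullet> (P *v z) \<le> v \<bullet> (P *v v)"
    using continuous_attains_inf[OF compact_sphere _ cont] by blast
  let ?c = "z \<bullet> (P *v z)"
  have "z \<noteq> 0" using z(1) by auto
  then have pos: "?c > 0" using assms by (simp add: posdef_def)
  have "?c * (v \<bullet> v) \<le> v \<bullet> (P *v v)" for v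
  proof (cases "v = 0")
    case False
    have "?c \<le> sgn v \<bullet> (P *v sgn v)" using z(2)[of "sgn v"] False by (simp add: norm_sgn)
    also have "\<dots> = (v \<bullet> (P *v v)) / (v \<bullet> v)"
      by (simp add: sgn_div_norm matrix_vector_mult_scaleR dot_square_norm power2_eq_square divide_inverse mult.assoc)
    finally show ?thesis using False by (simp add: field_simps)
  qed simp
  then show ?thesis using that pos by blast
qed

section \<open>Lyapunov operators\<close>

text \<open>The operator of a discrete Lyapunov equation. Replacing each \<open>G j\<close> by its transpose yields the operator that
  propagates second moment matrices, which is its adjoint for the trace inner product.\<close>

definition congr_sum :: "'j set \<Rightarrow> ('j \<Rightarrow> real^'n^'n) \<Rightarrow> real^'n^'n \<Rightarrow> real^'n^'n" where
  "congr_sum J G P = (\<Sum>j\<in>J. transpose (G j) ** P ** G j)"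

lemma quadratic_congr_sum:
  "v \<bullet> (congr_sum J G P *v v) = (\<Sum>j\<in>J. (G j *v v) \<bullet> (P *v (G j *v v)))"
  by (simp add: congr_sum_def sum_matrix_vector_mult inner_sum_right
      matrix_vector_mul_assoc[symmetric] inner_transpose_mult)

lemma linear_congr_sum: "linear (congr_sum J G)"
  unfolding congr_sum_def
  by (intro linear_compose_sum ballI linearI)
     (simp_all add: matrix_add_ldistrib matrix_add_rdistrib scaleR_matrix_mult_left scaleR_matrix_mult_right)

lemma inner_matrix_mult_left: "(G ** Z) \<bullet> P = Z \<bullet> (transpose G ** (P::real^'n^'n))"
proof -
  have "(G ** Z) \<bullet> P = (\<Sum>i\<in>UNIV. \<Sum>j\<in>UNIV. \<Sum>k\<in>UNIV. G$i$k * Z$k$j * P$i$j)"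
    by (simp add: inner_vec_def matrix_matrix_mult_def sum_distrib_right)
  also have "\<dots> = (\<Sum>k\<in>UNIV. \<Sum>j\<in>UNIV. \<Sum>i\<in>UNIV. G$i$k * Z$k$j * P$i$j)"
    by (subst (2) sum.swap, subst sum.swap, subst (2) sum.swap, rule refl)
  also have "\<dots> = Z \<bullet> (transpose G ** P)"
    by (simp add: inner_vec_def matrix_matrix_mult_def sum_distrib_left transpose_def mult_ac)
  finally show ?thesis .
qed

lemma inner_transpose_transpose: "transpose Z \<bullet> transpose P = (Z::real^'n^'n) \<bullet> P"
  by (simp add: inner_vec_def transpose_def) (rule sum.swap)

lemma inner_matrix_mult_right: "(Z ** G) \<bullet> P = Z \<bullet> (P ** transpose (G::real^'n^'n))"
  for Z :: "real^'n^'n"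
  using inner_matrix_mult_left[of "transpose G" "transpose Z" "transpose P"]
    inner_transpose_transpose[of "Z ** G" P] inner_transpose_transpose[of Z "P ** transpose G"]
  by (simp add: matrix_transpose_mul)

lemma congr_sum_adjoint:
  "congr_sum J (\<lambda>j. transpose (G j)) Z \<bullet> P = Z \<bullet> congr_sum J G P"
proof -
  have "(G j ** Z ** transpose (G j)) \<bullet> P = Z \<bullet> (transpose (G j) ** P ** G j)" for j
    unfolding inner_matrix_mult_right[of "G j ** Z"] inner_matrix_mult_left[of "G j" Z]
    by (simp add: matrix_mul_assoc)
  then show ?thesis by (simp add: congr_sum_def inner_sum_left inner_sum_right)
qed

lemma mat_1_inner: "mat 1 \<bullet> (Z::real^'n^'n) = (\<Sum>i\<in>UNIV. axis i 1 \<bullet> (Z *v axis i 1))"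
proof -
  have "axis i 1 \<bullet> (Z *v axis i 1) = Z$i$i" for i
    by (simp add: inner_axis' matrix_vector_mult_basis column_def)
  then show ?thesis
    by (simp add: inner_vec_def mat_def if_distrib[of "\<lambda>x. x * _"] cong: if_cong)
qed

text \<open>Quadratic forms are trace pairings with rank-one matrices. This is how a bound for all pairings
  becomes a bound on a quadratic form, and how limits pass through quadratic forms.\<close>

lemma rank_one_inner: "(\<chi> i j. v$i * v$j) \<bullet> Z = v \<bullet> (Z *v (v::real^'n))"
  by (simp add: inner_vec_def matrix_vector_mult_def sum_distrib_left mult_ac)

lemma rank_one_quadratic: "w \<bullet> ((\<chi> i j. v$i * v$j) *v w) = (v \<bullet> (w::real^'n))\<^sup>2"
  by (simp add: inner_vec_def matrix_vector_mult_def power2_eq_square sum_distrib_left sum_distrib_right mult_ac)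

text \<open>Let \<open>T\<close> be the operator with the gains \<open>G\<close> and \<open>W k = T^k I\<close>. Pairing the assumed inequality with \<open>W k\<close>
  gives \<open>\<epsilon> tr (W k) \<le> \<langle>X, W k\<rangle> - \<langle>X, W (k + 1)\<rangle>\<close>, because \<open>T\<close> and the operator in the assumption are
  adjoint. The right side telescopes, so the traces are summable and some \<open>W (N + 1)\<close> is smaller than \<open>I\<close>. Then
  \<open>P = W 0 + ... + W N\<close> works, as \<open>P - T P = I - W (N + 1)\<close>.\<close>

theorem dual_lyapunov_inequality:
  fixes X :: "real^'n^'n"
  assumes psd: "\<And>v. 0 \<le> v \<bullet> (X *v v)" and "\<epsilon> > 0"
    and dual: "\<And>v. \<epsilon> * (v \<bullet> v) + (\<Sum>j\<in>J. (transpose (G j) *v v) \<bullet> (X *v (transpose (G j) *v v)))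
              \<le> v \<bullet> (X *v v)"
  shows "\<exists>P. posdef P \<and> posdef (P - congr_sum J G P)"
proof -
  define W where "W k = (congr_sum J G ^^ k) (mat 1)" for k
  define pos :: "real^'n^'n \<Rightarrow> bool" where "pos Z \<longleftrightarrow> (\<forall>v. 0 \<le> v \<bullet> (Z *v v))" for Z
  have W0: "W 0 = mat 1" and WS: "W (Suc k) = congr_sum J G (W k)" for k
    by (simp_all add: W_def)
  have symW: "transpose (W k) = W k" for k
    by (induction k) (simp_all add: W0 WS congr_sum_def transpose_sum matrix_transpose_mul
      matrix_mul_assoc)
  \<comment> \<open>The trace of a product of two positive semidefinite matrices is nonnegative. For the second
     factor \<open>W k\<close> this is elementary: it holds for \<open>I\<close>, and \<open>T\<close> preserves it by adjointness.\<close>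
  have cone: "0 \<le> Z \<bullet> W k" if "pos Z" for Z k
    using that
  proof (induction k arbitrary: Z)
    case 0
    then show ?case by (simp add: W0 inner_commute[of Z] mat_1_inner pos_def sum_nonneg)
  next
    case (Suc k)
    then have "pos (congr_sum J (\<lambda>j. transpose (G j)) Z)"
      by (simp add: pos_def quadratic_congr_sum sum_nonneg)
    then show ?case using Suc.IH by (simp add: WS congr_sum_adjoint[symmetric])
  qed
  have W_nonneg: "0 \<le> v \<bullet> (W k *v v)" for v k
    using cone[of "\<chi> i j. v$i * v$j" k] by (simp add: pos_def rank_one_inner rank_one_quadratic)
  \<comment> \<open>Pairing with \<open>(v \<bullet> v) I - v v'\<close>, which is positive semidefinite by Cauchy--Schwarz.\<close>
  have W_le_trace: "v \<bullet> (W k *v v) \<le> (v \<bullet> v) * (mat 1 \<bullet> W k)" for v k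
  proof -
    have "pos ((v \<bullet> v) *\<^sub>R mat 1 - (\<chi> i j. v$i * v$j))"
      by (simp add: pos_def matrix_vector_mult_diff_rdistrib inner_diff_right rank_one_quadratic
          scaleR_matrix_vector_assoc[symmetric] Cauchy_Schwarz_ineq)
    from cone[OF this] show ?thesis by (simp add: inner_diff_left rank_one_inner)
  qed
  have decrease: "\<epsilon> * (mat 1 \<bullet> W k) \<le> X \<bullet> W k - X \<bullet> W (Suc k)" for k
  proof -
    have "pos (X - congr_sum J (\<lambda>j. transpose (G j)) X - \<epsilon> *\<^sub>R mat 1)"
      using dual by (simp add: pos_def matrix_vector_mult_diff_rdistrib inner_diff_right
          quadratic_congr_sum scaleR_matrix_vector_assoc[symmetric] algebra_simps)
    from cone[OF this, of k] show ?thesis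
      by (simp add: inner_diff_left congr_sum_adjoint WS)
  qed
  have "\<epsilon> * (\<Sum>k<N. mat 1 \<bullet> W k) \<le> X \<bullet> W 0 - X \<bullet> W N" for N
  proof (induction N)
    case (Suc N)
    then show ?case using decrease[of N] by (simp add: distrib_left)
  qed simp
  moreover have "0 \<le> X \<bullet> W N" for N using cone psd by (simp add: pos_def)
  ultimately have bound: "\<epsilon> * (\<Sum>k<N. mat 1 \<bullet> W k) \<le> X \<bullet> W 0" for N
    by (smt (verit))
  obtain N where N: "mat 1 \<bullet> W (Suc N) < 1"
  proof (rule ccontr)
    assume "\<not> thesis"
    then have ge: "1 \<le> mat 1 \<bullet> W (Suc k)" for k using that by (meson not_less)
    obtain m :: nat where m: "X \<bullet> W 0 / \<epsilon> < m" using reals_Archimedean2 by blast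
    have "real m \<le> (\<Sum>k<m. mat 1 \<bullet> W (Suc k))"
      using sum_mono[of "{..<m}" "\<lambda>_. 1" "\<lambda>k. mat 1 \<bullet> W (Suc k)"] ge by simp
    also have "\<dots> \<le> (\<Sum>k<Suc m. mat 1 \<bullet> W k)"
      using cone[of "mat 1" 0] by (simp add: sum.lessThan_Suc_shift pos_def del: sum.lessThan_Suc)
    finally have "\<epsilon> * m \<le> X \<bullet> W 0" using bound[of "Suc m"] \<open>\<epsilon> > 0\<close> 
      by (meson mult_left_mono order_less_imp_le order_trans)
    then show False using m \<open>\<epsilon> > 0\<close> by (simp add: field_simps)
  qed
  define P where "P = (\<Sum>k\<le>N. W k)"
  have quadP: "v \<bullet> (P *v v) = (\<Sum>k\<le>N. v \<bullet> (W k *v v))" for v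
    by (simp add: P_def sum_matrix_vector_mult inner_sum_right)
  have "v \<bullet> v \<le> v \<bullet> (P *v v)" for v
  proof -
    have "v \<bullet> (W 0 *v v) \<le> v \<bullet> (P *v v)"
      unfolding quadP by (intro member_le_sum) (simp_all add: W_nonneg)
    then show ?thesis by (simp add: W0)
  qed
  then have "0 < v \<bullet> (P *v v)" if "v \<noteq> 0" for v
    using that less_le_trans[of 0 "v \<bullet> v" "v \<bullet> (P *v v)"] by simp
  moreover have "transpose P = P" by (simp add: P_def transpose_sum symW)
  ultimately have "posdef P" by (simp add: posdef_def)
  moreover have "P - congr_sum J G P = mat 1 - W (Suc N)"
  proof -
    have "congr_sum J G P = (\<Sum>k\<le>N. W (Suc k))"
      by (simp add: P_def linear_sum[OF linear_congr_sum] WS)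
    moreover have "P + W (Suc N) = mat 1 + (\<Sum>k\<le>N. W (Suc k))"
      using sum.atMost_Suc_shift[of W N] by (simp add: P_def W0)
    ultimately show ?thesis by (simp add: algebra_simps)
  qed
  moreover have "posdef (mat 1 - W (Suc N))"
  proof -
    have "0 < v \<bullet> ((mat 1 - W (Suc N)) *v v)" if "v \<noteq> 0" for v
    proof -
      have "(v \<bullet> v) * (mat 1 \<bullet> W (Suc N)) < v \<bullet> v" using N that by simp
      then show ?thesis using W_le_trace[of v "Suc N"]
        by (simp add: matrix_vector_mult_diff_rdistrib inner_diff_right)
    qed
    then show ?thesis by (simp add: posdef_def transpose_diff symW)
  qed
  ultimately show ?thesis by metis
qed

text \<open>Polarization: convergence of all quadratic forms forces convergence of the matrices.\<close>

lemma symmetric_matrix_entry: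
  fixes P :: "real^'n^'n"
  assumes "transpose P = P"
  shows "P$i$j = ((axis i 1 + axis j 1) \<bullet> (P *v (axis i 1 + axis j 1))
     - axis i 1 \<bullet> (P *v axis i 1) - axis j 1 \<bullet> (P *v axis j 1)) / 2"
proof -
  have e: "axis i 1 \<bullet> (P *v axis j 1) = P$i$j" for i j
    by (simp add: inner_axis' matrix_vector_mult_basis column_def)
  have "P$j$i = P$i$j" by (subst assms[symmetric]) (simp add: transpose_def)
  then show ?thesis
    by (simp add: matrix_vector_right_distrib inner_add_left inner_add_right e)
qed

text \<open>Iterate \<open>P \<mapsto> Q + T P\<close> from \<open>0\<close>. The iterates increase since \<open>T\<close> is monotone. They stay below \<open>c R\<close> as
  soon as \<open>Q \<le> c (R - T R)\<close>, and the strict inequality for \<open>R\<close> provides such a \<open>c\<close>. A monotone bounded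
  sequence of symmetric matrices converges.\<close>

theorem lyapunov_equation_solvable:
  fixes R Q :: "real^'n^'n"
  assumes "posdef R" and H: "posdef (R - congr_sum J G R)" and Q: "posdef Q"
  shows "\<exists>P. posdef P \<and> P = Q + congr_sum J G P"
proof -
  let ?T = "congr_sum J G"
  obtain h where h: "h > 0" "\<And>v. h * (v \<bullet> v) \<le> v \<bullet> ((R - ?T R) *v v)"
    using posdef_ge[OF H] by blast
  obtain q where q: "q > 0" "\<And>v. v \<bullet> (Q *v v) \<le> q * (v \<bullet> v)"
    by (rule quadratic_form_le[of Q]) blast
  define c where "c = q / h"
  have Qc: "v \<bullet> (Q *v v) \<le> c * (v \<bullet> (R *v v) - v \<bullet> (?T R *v v))" for v
  proof -
    have "v \<bullet> (Q *v v) \<le> c * (h * (v \<bullet> v))" using q(2) h(1) by (simp add: c_def)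
    also have "\<dots> \<le> c * (v \<bullet> ((R - ?T R) *v v))"
      using h q(1) by (intro mult_left_mono h(2)) (simp add: c_def)
    finally show ?thesis by (simp add: matrix_vector_mult_diff_rdistrib inner_diff_right)
  qed
  define P where "P k = ((\<lambda>Z. Q + ?T Z) ^^ k) 0" for k
  have P0: "P 0 = 0" and PS: "P (Suc k) = Q + ?T (P k)" for k by (simp_all add: P_def)
  have sym: "transpose (P k) = P k" for k
    using Q by (induction k) (simp_all add: P0 PS congr_sum_def transpose_sum transpose_add
      matrix_transpose_mul matrix_mul_assoc posdef_def, simp add: transpose_def vec_eq_iff)
  have quadS: "v \<bullet> (P (Suc k) *v v) = v \<bullet> (Q *v v) + (\<Sum>j\<in>J. (G j *v v) \<bullet> (P k *v (G j *v v)))" for v k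
    by (simp add: PS matrix_vector_mult_add_rdistrib inner_add_right quadratic_congr_sum)
  have upper: "v \<bullet> (P k *v v) \<le> c * (v \<bullet> (R *v v))" for v k
  proof (induction k arbitrary: v)
    case 0
    have "0 \<le> v \<bullet> (R *v v)" using \<open>posdef R\<close> by (cases "v = 0") (auto simp: posdef_def intro: less_imp_le)
    then show ?case using h(1) q(1) by (simp add: P0 c_def)
  next
    case (Suc k)
    have "v \<bullet> (P (Suc k) *v v) \<le> c * (v \<bullet> (R *v v) - v \<bullet> (?T R *v v)) + c * (v \<bullet> (?T R *v v))"
      unfolding quadS
      by (intro add_mono Qc) (simp add: quadratic_congr_sum sum_distrib_left sum_mono Suc.IH)
    then show ?case by (simp add: algebra_simps)
  qed
  have mono: "v \<bullet> (P k *v v) \<le> v \<bullet> (P (Suc k) *v v)" for v k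
  proof (induction k arbitrary: v)
    case 0
    show ?case using Q by (cases "v = 0") (auto simp: P0 PS linear_0[OF linear_congr_sum] posdef_def intro: less_imp_le)
  next
    case (Suc k)
    show ?case unfolding quadS[of v k] quadS[of v "Suc k"]
      by (intro add_mono sum_mono Suc.IH) simp
  qed
  have conv: "convergent (\<lambda>k. v \<bullet> (P k *v v))" for v
  proof -
    have "incseq (\<lambda>k. v \<bullet> (P k *v v))" by (rule incseq_SucI) (rule mono)
    then obtain l where "(\<lambda>k. v \<bullet> (P k *v v)) \<longlonglongrightarrow> l"
      by (rule incseq_convergent[where B = "c * (v \<bullet> (R *v v))"]) (auto simp: upper)
    then show ?thesis by (auto simp: convergent_def)
  qed
  have "convergent (\<lambda>k. P k $ i $ j)" for i j
  proof -
    have "convergent (\<lambda>k. ((axis i 1 + axis j 1) \<bullet> (P k *v (axis i 1 + axis j 1))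
        - axis i 1 \<bullet> (P k *v axis i 1) - axis j 1 \<bullet> (P k *v axis j 1)) * (1/2))"
      by (intro convergent_mult convergent_diff conv convergent_const)
    then show ?thesis unfolding symmetric_matrix_entry[OF sym, of _ i j] by simp
  qed
  then obtain l where l: "\<And>i j. (\<lambda>k. P k $ i $ j) \<longlonglongrightarrow> l i j"
    unfolding convergent_def by metis
  define Z :: "real^'n^'n" where "Z = (\<chi> i j. l i j)"
  have lim: "P \<longlonglongrightarrow> Z"
    by (intro vec_tendstoI) (simp add: Z_def l)
  have "(\<lambda>k. P (Suc k)) \<longlonglongrightarrow> Q + ?T Z"
    unfolding PS
    using linear_congr_sum[of J G]
    by (intro tendsto_add tendsto_const bounded_linear.tendsto[OF _ lim])
       (simp add: linear_conv_bounded_linear)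
  then have eq: "Z = Q + ?T Z"
    using LIMSEQ_Suc[OF lim] LIMSEQ_unique by blast
  have "P k $ j $ i = P k $ i $ j" for k i j
    using arg_cong[OF sym[of k], of "\<lambda>G. G $ i $ j"] by (simp add: transpose_def)
  then have "l j i = l i j" for i j
    using LIMSEQ_unique[OF l[of j i], of "l i j"] l[of i j] by simp
  then have "transpose Z = Z" by (simp add: Z_def transpose_def)
  moreover have "0 < v \<bullet> (Z *v v)" if "v \<noteq> 0" for v
  proof -
    have "(\<lambda>k. v \<bullet> (P k *v v)) \<longlonglongrightarrow> v \<bullet> (Z *v v)"
      unfolding rank_one_inner[symmetric] by (intro tendsto_inner tendsto_const lim)
    moreover have "v \<bullet> (P 1 *v v) \<le> v \<bullet> (P k *v v)" if "k \<ge> 1" for k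
      using that by (rule lift_Suc_mono_le[of "\<lambda>k. v \<bullet> (P k *v v)", OF mono])
    ultimately have "v \<bullet> (P 1 *v v) \<le> v \<bullet> (Z *v v)"
      by (meson LIMSEQ_le_const)
    moreover have "P 1 = Q" by (simp add: P_def linear_0[OF linear_congr_sum])
    ultimately show ?thesis using Q that by (auto simp: posdef_def intro: less_le_trans)
  qed
  ultimately have "posdef Z" by (simp add: posdef_def)
  with eq show ?thesis by blast
qed

text \<open>The quadratic form is that of a pair \<open>(\<beta>, u)\<close> with second moments \<open>X, Y, U\<close>, and \<open>K = Y X^{-1}\<close> is the
  regression gain of \<open>u\<close> on \<open>\<beta>\<close>: replacing \<open>u\<close> by \<open>K \<beta>\<close> discards the residual \<open>u - K \<beta>\<close>, which is
  uncorrelated with \<open>\<beta>\<close>, and can only decrease the second moment of \<open>v \<bullet> \<beta> + w \<bullet> u\<close>.\<close>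

lemma schur_complement:
  fixes X :: "real^'n^'n" and Y :: "real^'n^'m" and U :: "real^'m^'m"
  assumes "posdef X"
    and nonneg: "\<And>v w. 0 \<le> v \<bullet> (X *v v) + 2 * (w \<bullet> (Y *v v)) + w \<bullet> (U *v w)"
  shows "\<exists>K. \<forall>v w. (v + transpose K *v w) \<bullet> (X *v (v + transpose K *v w))
           \<le> v \<bullet> (X *v v) + 2 * (w \<bullet> (Y *v v)) + w \<bullet> (U *v w)"
proof -
  have symX: "transpose X = X" using assms(1) by (simp add: posdef_def)
  have "X *v v = 0 \<Longrightarrow> v = 0" for v
    using assms(1) by (metis inner_zero_right order_less_irrefl posdef_def)
  then obtain Xi where "Xi ** X = mat 1" by (metis matrix_left_invertible_ker)
  then have YK: "(Y ** Xi) ** X = Y" by (simp add: matrix_mul_assoc[symmetric])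
  define K where "K = Y ** Xi"
  have wY: "w \<bullet> (Y *v v) = (transpose K *v w) \<bullet> (X *v v)" for v w
    using inner_mult_eq_transpose[of w K "X *v v"]
    unfolding matrix_vector_mul_assoc K_def YK .
  have comm: "a \<bullet> (X *v b) = b \<bullet> (X *v a)" for a b
    using inner_mult_eq_transpose[of a X b] by (simp add: symX inner_commute)
  have "(v + transpose K *v w) \<bullet> (X *v (v + transpose K *v w))
           \<le> v \<bullet> (X *v v) + 2 * (w \<bullet> (Y *v v)) + w \<bullet> (U *v w)" for v w
  proof -
    let ?k = "transpose K *v w"
    have "X *v (- ?k) = - (X *v ?k)"
      by (metis matrix_vector_mult_scaleR scaleR_minus1_left)
    then have "?k \<bullet> (X *v ?k) \<le> w \<bullet> (U *v w)"
      using nonneg[of "- ?k" w] by (simp add: wY)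
    then show ?thesis
      using comm[of v ?k] by (simp add: wY matrix_vector_right_distrib inner_add_left inner_add_right)
  qed
  then show ?thesis by blast
qed


section \<open>Independence of the noise\<close>

context delay_noise
begin

lemma random_variable_noise: "\<tau> \<le> D \<Longrightarrow> random_variable borel (\<omega> \<tau> t)"
  using independent_in_time[of \<tau>] by (auto simp: indep_vars_def)

definition noise_events :: "nat \<times> nat \<Rightarrow> 'w set set" where
  "noise_events = (\<lambda>(\<tau>, s). {\<omega> \<tau> s -` S \<inter> space M |S. S \<in> sets borel})"

definition noise_algebra :: "(nat \<times> nat) set \<Rightarrow> 'w measure" where
  "noise_algebra I = sigma (space M) (\<Union>i\<in>I. noise_events i)"

text \<open>Independence over time within each channel and independence of the channels as whole paths
  combine to joint independence of all noise variables: an event fixing finitely many of them is an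
  intersection of path events, one for each channel that occurs, and both products factorize in turn.\<close>

lemma indep_noise_events: "indep_sets noise_events ({..D} \<times> UNIV)"
proof (rule indep_setsI)
  fix i assume "i \<in> {..D} \<times> (UNIV::nat set)"
  then show "noise_events i \<subseteq> events"
    by (auto simp: noise_events_def measurable_sets[OF random_variable_noise])
next
  fix F :: "nat \<times> nat \<Rightarrow> 'w set" and J :: "(nat \<times> nat) set"
  assume J: "J \<noteq> {}" "J \<subseteq> {..D} \<times> UNIV" "finite J" and F: "\<forall>j\<in>J. F j \<in> noise_events j"
  have "\<forall>j\<in>J. \<exists>S. S \<in> sets borel \<and> F j = \<omega> (fst j) (snd j) -` S \<inter> space M"
  proof
    fix j assume "j \<in> J"
    then have "F j \<in> noise_events (fst j, snd j)" using F by simp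
    then show "\<exists>S. S \<in> sets borel \<and> F j = \<omega> (fst j) (snd j) -` S \<inter> space M"
      unfolding noise_events_def by auto
  qed
  then obtain S where "\<forall>j\<in>J. S j \<in> sets borel \<and> F j = \<omega> (fst j) (snd j) -` S j \<inter> space M"
    by (rule bchoice[THEN exE])
  then have S: "S (\<tau>, s) \<in> sets borel" "F (\<tau>, s) = \<omega> \<tau> s -` S (\<tau>, s) \<inter> space M"
    if "(\<tau>, s) \<in> J" for \<tau> s
    using that by auto
  define T where "T \<tau> = {s. (\<tau>, s) \<in> J}" for \<tau>
  have "T \<tau> \<subseteq> snd ` J" for \<tau> by (force simp: T_def)
  then have fin: "finite (fst ` J)" "finite (T \<tau>)" for \<tau>
    using J(3) finite_subset by blast+
  have J_eq: "J = (SIGMA \<tau>:fst ` J. T \<tau>)" by (force simp: T_def)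
  have T_ne: "T \<tau> \<noteq> {}" if "\<tau> \<in> fst ` J" for \<tau> using that by (auto simp: T_def)
  define path where "path \<tau> = {p :: nat \<Rightarrow> real. \<forall>s\<in>T \<tau>. p s \<in> S (\<tau>, s)}" for \<tau>
  have F_eq: "F (\<tau>, s) = \<omega> \<tau> s -` S (\<tau>, s) \<inter> space M" if "s \<in> T \<tau>" for \<tau> s
    using that by (intro S(2)) (simp add: T_def)
  have path: "(\<lambda>w t. \<omega> \<tau> t w) -` path \<tau> \<inter> space M = (\<Inter>s\<in>T \<tau>. \<omega> \<tau> s -` S (\<tau>, s) \<inter> space M)"
    if "\<tau> \<in> fst ` J" for \<tau>
    using T_ne[OF that] by (auto simp: path_def)
  have path_sets: "path \<tau> \<in> sets (Pi\<^sub>M UNIV (\<lambda>_. borel))" for \<tau>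
  proof -
    have "path \<tau> = {p \<in> space (Pi\<^sub>M UNIV (\<lambda>_. borel)). \<forall>s\<in>T \<tau>. p s \<in> S (\<tau>, s)}"
      by (simp add: path_def space_PiM)
    also have "\<dots> \<in> sets (Pi\<^sub>M UNIV (\<lambda>_. borel))"
    proof (rule sets.sets_Collect_finite_All[OF _ fin(2)])
      fix s assume "s \<in> T \<tau>"
      then have "S (\<tau>, s) \<in> sets borel" using S(1) by (simp add: T_def)
      then have "(\<lambda>p. p s) -` S (\<tau>, s) \<inter> space (Pi\<^sub>M UNIV (\<lambda>_::nat. borel)) \<in> sets (Pi\<^sub>M UNIV (\<lambda>_. borel))"
        by (intro measurable_sets[OF measurable_component_singleton]) simp_all
      then show "{p \<in> space (Pi\<^sub>M UNIV (\<lambda>_. borel)). p s \<in> S (\<tau>, s)} \<in> sets (Pi\<^sub>M UNIV (\<lambda>_. borel))"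
        by (simp add: vimage_def Int_def conj_commute)
    qed
    finally show ?thesis .
  qed
  have "(\<Inter>j\<in>J. F j) = (\<Inter>\<tau>\<in>fst ` J. \<Inter>s\<in>T \<tau>. F (\<tau>, s))"
    by (force simp: T_def)
  also have "\<dots> = (\<Inter>\<tau>\<in>fst ` J. (\<lambda>w t. \<omega> \<tau> t w) -` path \<tau> \<inter> space M)"
    using F_eq path by (intro INF_cong) simp_all
  also have "prob \<dots> = (\<Prod>\<tau>\<in>fst ` J. prob ((\<lambda>w t. \<omega> \<tau> t w) -` path \<tau> \<inter> space M))"
    by (rule indep_varsD[OF independent_channels]) (use J fin path_sets in auto)
  also have "\<dots> = (\<Prod>\<tau>\<in>fst ` J. \<Prod>s\<in>T \<tau>. prob (F (\<tau>, s)))"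
  proof (rule prod.cong[OF refl])
    fix \<tau> assume \<tau>: "\<tau> \<in> fst ` J"
    have "prob (\<Inter>s\<in>T \<tau>. \<omega> \<tau> s -` S (\<tau>, s) \<inter> space M)
        = (\<Prod>s\<in>T \<tau>. prob (\<omega> \<tau> s -` S (\<tau>, s) \<inter> space M))"
    proof (rule indep_varsD[OF independent_in_time])
      show "\<tau> \<le> D" using J(2) \<tau> by auto
      show "S (\<tau>, s) \<in> sets borel" if "s \<in> T \<tau>" for s using that S(1) by (simp add: T_def)
    qed (use T_ne[OF \<tau>] fin in simp_all)
    then show "prob ((\<lambda>w t. \<omega> \<tau> t w) -` path \<tau> \<inter> space M) = (\<Prod>s\<in>T \<tau>. prob (F (\<tau>, s)))"
      using F_eq by (simp add: path[OF \<tau>])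
  qed
  also have "\<dots> = (\<Prod>j\<in>J. prob (F j))"
    using prod.Sigma[of "fst ` J" T "\<lambda>\<tau> s. prob (F (\<tau>, s))"] fin
    by (simp add: J_eq[symmetric])
  finally show "prob (\<Inter>j\<in>J. F j) = (\<Prod>j\<in>J. prob (F j))" .
qed

lemma noise_events_subset: "noise_events i \<subseteq> Pow (space M)"
  by (auto simp: noise_events_def split: prod.splits)

lemma space_noise_algebra [simp]: "space (noise_algebra I) = space M"
  by (simp add: noise_algebra_def space_measure_of_conv)

lemma sets_noise_algebra: "sets (noise_algebra I) = sigma_sets (space M) (\<Union>i\<in>I. noise_events i)"
  unfolding noise_algebra_def using noise_events_subset by (intro sets_measure_of) auto

lemma noise_algebra_mono: "I \<subseteq> I' \<Longrightarrow> sets (noise_algebra I) \<subseteq> sets (noise_algebra I')"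
  unfolding sets_noise_algebra by (intro sigma_sets_mono') auto

lemma measurable_noise_algebra_mono:
  "f \<in> borel_measurable (noise_algebra I) \<Longrightarrow> I \<subseteq> I' \<Longrightarrow> f \<in> borel_measurable (noise_algebra I')"
  using noise_algebra_mono[of I I'] by (auto simp: measurable_def)

lemma measurable_noise: "(\<tau>, s) \<in> I \<Longrightarrow> \<omega> \<tau> s \<in> borel_measurable (noise_algebra I)"
  by (rule measurableI) (auto simp: sets_noise_algebra noise_events_def intro!: sigma_sets.Basic)

lemma random_variable_noise_algebra:
  assumes "f \<in> borel_measurable (noise_algebra I)" "I \<subseteq> {..D} \<times> UNIV"
  shows "random_variable borel f"
proof -
  have "sets (noise_algebra I) \<subseteq> events"
    unfolding sets_noise_algebra using indep_noise_events assms(2)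
    by (intro sets.sigma_sets_subset) (auto simp: indep_sets_def)
  then show ?thesis using assms(1) by (auto simp: measurable_def)
qed

lemma indep_var_disjoint_noise:
  assumes "f \<in> borel_measurable (noise_algebra I)" "g \<in> borel_measurable (noise_algebra I')"
    and "I \<subseteq> {..D} \<times> UNIV" "I' \<subseteq> {..D} \<times> UNIV" "I \<inter> I' = {}"
  shows "indep_var borel f borel g"
proof -
  have "indep_sets (\<lambda>b. sigma_sets (space M) (\<Union>i\<in>case_bool I I' b. noise_events i)) UNIV"
  proof (rule indep_sets_collect_sigma)
    show "indep_sets noise_events (\<Union>b\<in>UNIV. case_bool I I' b)"
      by (rule indep_sets_mono_index[OF _ indep_noise_events]) (use assms in \<open>auto simp: UNIV_bool\<close>)
    show "disjoint_family_on (case_bool I I') UNIV"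
      using assms(5) by (auto simp: disjoint_family_on_def split: bool.splits)
    fix i show "Int_stable (noise_events i)"
    proof (rule Int_stableI)
      fix a b assume "a \<in> noise_events i" "b \<in> noise_events i"
      then obtain S S' where S: "S \<in> sets borel" "S' \<in> sets borel"
        and "a = \<omega> (fst i) (snd i) -` S \<inter> space M" "b = \<omega> (fst i) (snd i) -` S' \<inter> space M"
        by (auto simp: noise_events_def case_prod_unfold)
      then have "a \<inter> b = \<omega> (fst i) (snd i) -` (S \<inter> S') \<inter> space M" by auto
      moreover have "S \<inter> S' \<in> sets borel" using S by (rule sets.Int)
      ultimately show "a \<inter> b \<in> noise_events i"
        unfolding noise_events_def case_prod_unfold mem_Collect_eq by (intro exI conjI)
    qed
  qed
  then have "indep_set (sets (noise_algebra I)) (sets (noise_algebra I'))"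
    unfolding indep_set_def sets_noise_algebra
    by (rule indep_sets_mono_sets) (simp split: bool.splits)
  then have "indep_set (sigma_sets (space M) {f -` A \<inter> space M |A. A \<in> sets borel})
     (sigma_sets (space M) {g -` A \<inter> space M |A. A \<in> sets borel})"
    unfolding indep_set_def
  proof (rule indep_sets_mono_sets)
    have sub: "sigma_sets (space M) {h -` A \<inter> space M |A. A \<in> sets borel} \<subseteq> sets (noise_algebra J)"
      if "h \<in> borel_measurable (noise_algebra J)" for h :: "'w \<Rightarrow> 'z::topological_space" and J
    proof -
      have "{h -` A \<inter> space M |A. A \<in> sets borel} \<subseteq> sets (noise_algebra J)"
        using measurable_sets[OF that] by auto
      from sets.sigma_sets_subset[OF this] show ?thesis by simp
    qed
    show "(case b of True \<Rightarrow> sigma_sets (space M) {f -` A \<inter> space M |A. A \<in> sets borel}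
        | False \<Rightarrow> sigma_sets (space M) {g -` A \<inter> space M |A. A \<in> sets borel})
      \<subseteq> (case b of True \<Rightarrow> sets (noise_algebra I) | False \<Rightarrow> sets (noise_algebra I'))" for b
      using sub[OF assms(1)] sub[OF assms(2)] by (simp split: bool.splits)
  qed
  then show ?thesis
    using assms by (simp add: indep_var_eq random_variable_noise_algebra)
qed

text \<open>The noise strictly before time \<open>t\<close>, which the state at time \<open>t\<close> depends on; the noise entering
  the step from \<open>t\<close> to \<open>t + 1\<close> is independent of it.\<close>

abbreviation past :: "nat \<Rightarrow> 'w measure" where
  "past t \<equiv> noise_algebra ({..D} \<times> {..<t})"

lemma past_Suc_eq_noise_filtration: "past (Suc t) = noise_filtration M D \<omega> t"
proof -
  have "(\<Union>i\<in>{..D} \<times> {..<Suc t}. noise_events i) =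
      {\<omega> \<tau> s -` S \<inter> space M |\<tau> s S. \<tau> \<le> D \<and> s \<le> t \<and> S \<in> sets borel}"
    by (auto simp: noise_events_def) (force simp: less_Suc_eq_le)+
  then show ?thesis by (simp add: noise_algebra_def noise_filtration_def)
qed

lemma integrable_noise: "\<tau> \<le> D \<Longrightarrow> integrable M (\<omega> \<tau> t)"
  by (rule square_integrable_imp_integrable) (simp_all add: random_variable_noise square_integrable)

lemma noise_product:
  assumes "\<tau> \<le> D" "\<kappa> \<le> D"
  shows "integrable M (\<lambda>w. \<omega> \<tau> t w * \<omega> \<kappa> t w)"
    and "expectation (\<lambda>w. \<omega> \<tau> t w * \<omega> \<kappa> t w) = (if \<tau> = \<kappa> then (\<sigma> \<tau>)\<^sup>2 else 0)"
proof -
  have "indep_var borel (\<omega> \<tau> t) borel (\<omega> \<kappa> t)" if "\<tau> \<noteq> \<kappa>"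
    by (rule indep_var_disjoint_noise[of _ "{(\<tau>, t)}" _ "{(\<kappa>, t)}"])
       (use assms that in \<open>auto intro: measurable_noise\<close>)
  then have "\<tau> \<noteq> \<kappa> \<Longrightarrow> integrable M (\<lambda>w. \<omega> \<tau> t w * \<omega> \<kappa> t w)"
    "\<tau> \<noteq> \<kappa> \<Longrightarrow> expectation (\<lambda>w. \<omega> \<tau> t w * \<omega> \<kappa> t w) = 0"
    using assms by (simp_all add: indep_var_integrable indep_var_lebesgue_integral integrable_noise mean_zero)
  then show "integrable M (\<lambda>w. \<omega> \<tau> t w * \<omega> \<kappa> t w)"
    "expectation (\<lambda>w. \<omega> \<tau> t w * \<omega> \<kappa> t w) = (if \<tau> = \<kappa> then (\<sigma> \<tau>)\<^sup>2 else 0)"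
    using assms square_integrable[of \<tau> t] covariance[of \<tau> t t] by (auto simp: power2_eq_square)
qed

lemma noise_times_past:
  assumes "\<tau> \<le> D" "f \<in> borel_measurable (past t)" "integrable M f"
  shows "integrable M (\<lambda>w. \<omega> \<tau> t w * f w)" "expectation (\<lambda>w. \<omega> \<tau> t w * f w) = 0"
proof -
  have "indep_var borel (\<omega> \<tau> t) borel f"
    by (rule indep_var_disjoint_noise[of _ "{..D} \<times> {t}"]) (use assms in \<open>auto intro: measurable_noise\<close>)
  then show "integrable M (\<lambda>w. \<omega> \<tau> t w * f w)" "expectation (\<lambda>w. \<omega> \<tau> t w * f w) = 0"
    using assms by (simp_all add: indep_var_integrable indep_var_lebesgue_integral integrable_noise mean_zero)
qed

lemma noise_noise_times_past:
  assumes "\<tau> \<le> D" "\<kappa> \<le> D" "f \<in> borel_measurable (past t)" "integrable M f"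
  shows "integrable M (\<lambda>w. \<omega> \<tau> t w * \<omega> \<kappa> t w * f w)"
    "expectation (\<lambda>w. \<omega> \<tau> t w * \<omega> \<kappa> t w * f w) = (if \<tau> = \<kappa> then (\<sigma> \<tau>)\<^sup>2 * expectation f else 0)"
proof -
  have "indep_var borel (\<lambda>w. \<omega> \<tau> t w * \<omega> \<kappa> t w) borel f"
    by (rule indep_var_disjoint_noise[of _ "{..D} \<times> {t}"])
       (use assms in \<open>auto intro!: borel_measurable_times measurable_noise\<close>)
  then show "integrable M (\<lambda>w. \<omega> \<tau> t w * \<omega> \<kappa> t w * f w)"
    "expectation (\<lambda>w. \<omega> \<tau> t w * \<omega> \<kappa> t w * f w) = (if \<tau> = \<kappa> then (\<sigma> \<tau>)\<^sup>2 * expectation f else 0)"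
    using assms by (simp_all add: indep_var_integrable indep_var_lebesgue_integral noise_product)
qed

text \<open>The space in which all trajectories live. It is closed under matrices, sums and, with the time advanced by one,
  multiplication by the current noise, so membership of a trajectory follows by induction on time.\<close>

definition L2_past :: "nat \<Rightarrow> ('w \<Rightarrow> real^'k) \<Rightarrow> bool" where
  "L2_past t f \<longleftrightarrow> f \<in> borel_measurable (past t) \<and> integrable M (\<lambda>w. f w \<bullet> f w)"

lemma random_variable_past: "f \<in> borel_measurable (past t) \<Longrightarrow> random_variable borel f"
  by (rule random_variable_noise_algebra) auto

lemma L2_past_cong: "(\<And>w. w \<in> space M \<Longrightarrow> f w = g w) \<Longrightarrow> L2_past t f \<longleftrightarrow> L2_past t g"
  unfolding L2_past_def
  by (intro arg_cong2[where f = "(\<and>)"] measurable_cong Bochner_Integration.integrable_cong) auto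

lemma L2_past_mono: "L2_past t f \<Longrightarrow> t \<le> t' \<Longrightarrow> L2_past t' f"
  unfolding L2_past_def by (auto elim!: measurable_noise_algebra_mono)

lemma L2_past_const [simp]: "L2_past t (\<lambda>_. c)"
  by (simp add: L2_past_def)

lemma L2_past_matrix: "L2_past t f \<Longrightarrow> L2_past t (\<lambda>w. G *v f w)"
proof -
  assume f: "L2_past t f"
  have m: "(\<lambda>w. G *v f w) \<in> borel_measurable (past t)"
    using f borel_measurable_continuous_onI[OF linear_continuous_on[OF matrix_vector_mul_bounded_linear[of G]]]
    by (auto simp: L2_past_def intro: measurable_compose)
  obtain c where c: "c > 0" "\<And>v. (G *v v) \<bullet> (G *v v) \<le> c * (v \<bullet> v)"
    by (rule matrix_vector_mult_inner_bound[of G]) blast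
  have "integrable M (\<lambda>w. (G *v f w) \<bullet> (G *v f w))"
  proof (rule Bochner_Integration.integrable_bound)
    show "integrable M (\<lambda>w. c * (f w \<bullet> f w))" using f by (simp add: L2_past_def)
    show "(\<lambda>w. (G *v f w) \<bullet> (G *v f w)) \<in> borel_measurable M"
      using random_variable_past[OF m] by simp
  qed (use c in auto)
  with m show ?thesis by (simp add: L2_past_def)
qed

lemma inner_add_le: "(a + b) \<bullet> (a + b) \<le> 2 * (a \<bullet> a) + 2 * (b \<bullet> (b::'v::real_inner))"
  using inner_ge_zero[of "a - b"] by (simp add: algebra_simps inner_commute)

lemma L2_past_add:
  assumes "L2_past t f" "L2_past t g"
  shows "L2_past t (\<lambda>w. f w + g w)"
proof -
  have m: "(\<lambda>w. f w + g w) \<in> borel_measurable (past t)"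
    using assms unfolding L2_past_def by (intro borel_measurable_add) auto
  have "integrable M (\<lambda>w. (f w + g w) \<bullet> (f w + g w))"
  proof (rule Bochner_Integration.integrable_bound)
    show "integrable M (\<lambda>w. 2 * (f w \<bullet> f w) + 2 * (g w \<bullet> g w))" using assms by (simp add: L2_past_def)
    show "(\<lambda>w. (f w + g w) \<bullet> (f w + g w)) \<in> borel_measurable M"
      using random_variable_past[OF m] by simp
  qed (use inner_add_le in auto)
  with m show ?thesis by (simp add: L2_past_def)
qed

lemma L2_past_sum: "(\<And>i. i \<in> I \<Longrightarrow> L2_past t (f i)) \<Longrightarrow> L2_past t (\<lambda>w. \<Sum>i\<in>I. f i w)"
  by (induction I rule: infinite_finite_induct) (simp_all add: L2_past_add)

lemma L2_past_noise:
  assumes "\<tau> \<le> D" "L2_past t f"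
  shows "L2_past (Suc t) (\<lambda>w. \<omega> \<tau> t w *\<^sub>R f w)"
proof -
  have "integrable M (\<lambda>w. \<omega> \<tau> t w * \<omega> \<tau> t w * (f w \<bullet> f w))"
    by (rule noise_noise_times_past) (use assms in \<open>auto simp: L2_past_def\<close>)
  moreover have "f \<in> borel_measurable (past (Suc t))"
    using L2_past_mono[OF assms(2), of "Suc t"] by (simp add: L2_past_def)
  moreover have "\<omega> \<tau> t \<in> borel_measurable (past (Suc t))" using assms by (intro measurable_noise) auto
  ultimately show ?thesis by (simp add: L2_past_def mult.assoc)
qed

lemma L2_past_inner:
  assumes "L2_past t f" "L2_past t g"
  shows "(\<lambda>w. f w \<bullet> g w) \<in> borel_measurable (past t)" "integrable M (\<lambda>w. f w \<bullet> g w)"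
proof -
  show m: "(\<lambda>w. f w \<bullet> g w) \<in> borel_measurable (past t)"
    using assms unfolding L2_past_def by (intro borel_measurable_inner) auto
  show "integrable M (\<lambda>w. f w \<bullet> g w)"
  proof (rule Bochner_Integration.integrable_bound)
    show "integrable M (\<lambda>w. f w \<bullet> f w + g w \<bullet> g w)" using assms by (simp add: L2_past_def)
    show "(\<lambda>w. f w \<bullet> g w) \<in> borel_measurable M" using random_variable_past[OF m] by simp
    have "\<bar>f w \<bullet> g w\<bar> \<le> f w \<bullet> f w + g w \<bullet> g w" for w
    proof -
      have "0 \<le> f w \<bullet> f w + g w \<bullet> g w - 2 * (f w \<bullet> g w)"
        using inner_ge_zero[of "f w - g w"] by (simp add: algebra_simps inner_commute)
      moreover have "0 \<le> f w \<bullet> f w + g w \<bullet> g w + 2 * (f w \<bullet> g w)"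
        using inner_ge_zero[of "f w + g w"] by (simp add: algebra_simps inner_commute)
      ultimately show ?thesis by linarith
    qed
    then show "AE w in M. norm (f w \<bullet> g w) \<le> norm (f w \<bullet> f w + g w \<bullet> g w)" by fastforce
  qed
qed

text \<open>The noise variables at time \<open>t\<close> are centred, uncorrelated and independent of the past, so only the
  diagonal terms of the expanded quadratic form survive. The vectors multiplying them may come from any
  earlier time, which is why delays in the noise terms are harmless.\<close>

lemma second_moment_step:
  fixes P :: "real^'k^'k"
  assumes f: "L2_past t f" and g: "\<And>\<tau>. \<tau> \<le> D \<Longrightarrow> L2_past t (g \<tau>)"
  defines "y w \<equiv> f w + (\<Sum>\<tau>\<le>D. \<omega> \<tau> t w *\<^sub>R g \<tau> w)"
  shows "expectation (\<lambda>w. y w \<bullet> (P *v y w)) = expectation (\<lambda>w. f w \<bullet> (P *v f w))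
     + (\<Sum>\<tau>\<le>D. (\<sigma> \<tau>)\<^sup>2 * expectation (\<lambda>w. g \<tau> w \<bullet> (P *v g \<tau> w)))"
proof -
  define cross where "cross \<tau> w = f w \<bullet> (P *v g \<tau> w) + g \<tau> w \<bullet> (P *v f w)" for \<tau> w
  note q = L2_past_inner[OF _ L2_past_matrix]
  have expand: "y w \<bullet> (P *v y w) = f w \<bullet> (P *v f w) + (\<Sum>\<tau>\<le>D. \<omega> \<tau> t w * cross \<tau> w)
     + (\<Sum>\<tau>\<le>D. \<Sum>\<kappa>\<le>D. \<omega> \<tau> t w * \<omega> \<kappa> t w * (g \<kappa> w \<bullet> (P *v g \<tau> w)))" for w
    by (simp add: y_def cross_def matrix_vector_right_distrib matrix_vector_mult_sum_right
        matrix_vector_mult_scaleR inner_add_left inner_add_right inner_sum_left inner_sum_right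
        sum.distrib sum_distrib_left algebra_simps)
  have cross: "\<tau> \<le> D \<Longrightarrow> integrable M (\<lambda>w. \<omega> \<tau> t w * cross \<tau> w)"
    "\<tau> \<le> D \<Longrightarrow> expectation (\<lambda>w. \<omega> \<tau> t w * cross \<tau> w) = 0" for \<tau>
    unfolding cross_def using f g by (auto intro!: noise_times_past q borel_measurable_add Bochner_Integration.integrable_add)
  note sq = noise_noise_times_past[OF _ _ q[OF g g]]
  have "integrable M (\<lambda>w. \<Sum>\<tau>\<le>D. \<omega> \<tau> t w * cross \<tau> w)"
    and "expectation (\<lambda>w. \<Sum>\<tau>\<le>D. \<omega> \<tau> t w * cross \<tau> w) = 0"
    by (auto simp: cross Bochner_Integration.integral_sum intro!: Bochner_Integration.integrable_sum)
  moreover have "integrable M (\<lambda>w. \<Sum>\<tau>\<le>D. \<Sum>\<kappa>\<le>D. \<omega> \<tau> t w * \<omega> \<kappa> t w * (g \<kappa> w \<bullet> (P *v g \<tau> w)))"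
    by (intro Bochner_Integration.integrable_sum sq(1)) auto
  moreover have "expectation (\<lambda>w. \<Sum>\<tau>\<le>D. \<Sum>\<kappa>\<le>D. \<omega> \<tau> t w * \<omega> \<kappa> t w * (g \<kappa> w \<bullet> (P *v g \<tau> w)))
     = (\<Sum>\<tau>\<le>D. \<Sum>\<kappa>\<le>D. expectation (\<lambda>w. \<omega> \<tau> t w * \<omega> \<kappa> t w * (g \<kappa> w \<bullet> (P *v g \<tau> w))))"
    by (subst Bochner_Integration.integral_sum, (intro Bochner_Integration.integrable_sum sq(1); simp),
        intro sum.cong refl Bochner_Integration.integral_sum sq(1)) auto
  moreover have "\<dots> = (\<Sum>\<tau>\<le>D. \<Sum>\<kappa>\<le>D. if \<tau> = \<kappa> then (\<sigma> \<tau>)\<^sup>2 * expectation (\<lambda>w. g \<kappa> w \<bullet> (P *v g \<tau> w)) else 0)"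
    by (intro sum.cong refl sq(2)) auto
  ultimately have "expectation (\<lambda>w. y w \<bullet> (P *v y w)) = expectation (\<lambda>w. f w \<bullet> (P *v f w))
     + (\<Sum>\<tau>\<le>D. \<Sum>\<kappa>\<le>D. if \<tau> = \<kappa> then (\<sigma> \<tau>)\<^sup>2 * expectation (\<lambda>w. g \<kappa> w \<bullet> (P *v g \<tau> w)) else 0)"
    unfolding expand using q(2)[OF f f] by simp
  also have "\<dots> = expectation (\<lambda>w. f w \<bullet> (P *v f w))
     + (\<Sum>\<tau>\<le>D. (\<sigma> \<tau>)\<^sup>2 * expectation (\<lambda>w. g \<tau> w \<bullet> (P *v g \<tau> w)))"
    by (intro arg_cong2[where f = "(+)"] refl sum.cong) simp_all
  finally show ?thesis .
qed

end

section \<open>Systems with delays in the noise only\<close>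

text \<open>The drift and the noise gains, scaled by the standard deviations, listed as one family, so
  that the right-hand side of the Lyapunov equation is an instance of \<open>congr_sum\<close>.\<close>

definition closed_loop_gain ::
  "(nat \<Rightarrow> real) \<Rightarrow> real^'n^'n \<Rightarrow> real^'m^'n \<Rightarrow> (nat \<Rightarrow> real^'m^'n) \<Rightarrow> real^'n^'m \<Rightarrow> nat \<Rightarrow> real^'n^'n"
  where "closed_loop_gain \<sigma> A L E K j = (case j of 0 \<Rightarrow> A + L ** K | Suc \<tau> \<Rightarrow> \<sigma> \<tau> *\<^sub>R (E \<tau> ** K))"

lemma lyapunov_rhs_eq_congr_sum:
  "lyapunov_rhs D \<sigma> A L C K P
     = congr_sum {..Suc D} (closed_loop_gain \<sigma> A L (\<lambda>\<tau>. matpow A D ** C \<tau>) K) P"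
  unfolding lyapunov_rhs_def congr_sum_def closed_loop_gain_def sum.atMost_Suc_shift
  by (simp add: transpose_scaleR scaleR_matrix_mult_left scaleR_matrix_mult_right
      matrix_transpose_mul transpose_matpow matrix_mul_assoc power2_eq_square)

lemma quadratic_closed_loop:
  "v \<bullet> (congr_sum {..Suc D} (closed_loop_gain \<sigma> A L E K) P *v v)
     = ((A + L ** K) *v v) \<bullet> (P *v ((A + L ** K) *v v))
       + (\<Sum>\<tau>\<le>D. (\<sigma> \<tau>)\<^sup>2 * ((E \<tau> *v (K *v v)) \<bullet> (P *v (E \<tau> *v (K *v v)))))"
  unfolding quadratic_congr_sum sum.atMost_Suc_shift closed_loop_gain_def
  by (simp add: scaleR_matrix_vector_assoc[symmetric] matrix_vector_mult_scaleR
      matrix_vector_mul_assoc power2_eq_square mult.assoc)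

lemma quadratic_closed_loop_dual:
  "(\<Sum>j\<le>Suc D. (transpose (closed_loop_gain \<sigma> A L E K j) *v v)
        \<bullet> (X *v (transpose (closed_loop_gain \<sigma> A L E K j) *v v)))
     = (transpose A *v v + transpose K *v (transpose L *v v))
         \<bullet> (X *v (transpose A *v v + transpose K *v (transpose L *v v)))
       + (\<Sum>\<tau>\<le>D. (\<sigma> \<tau>)\<^sup>2 * ((transpose K *v (transpose (E \<tau>) *v v))
         \<bullet> (X *v (transpose K *v (transpose (E \<tau>) *v v)))))"
  unfolding sum.atMost_Suc_shift closed_loop_gain_def
  by (simp add: transpose_scaleR transpose_add matrix_transpose_mul matrix_vector_mult_add_rdistrib
      scaleR_matrix_vector_assoc[symmetric] matrix_vector_mult_scaleR
      matrix_vector_mul_assoc power2_eq_square mult.assoc)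

text \<open>Delaying a nonnegative sequence by \<open>d\<close> loses at most its last \<open>d\<close> terms before \<open>N\<close> from the sum up to \<open>N\<close>.\<close>

lemma sum_lessThan_shift_le:
  fixes g :: "int \<Rightarrow> real"
  assumes "\<And>s. 0 \<le> g s"
  shows "(\<Sum>t<N. g (int t)) \<le> (\<Sum>t<N. g (int t - int d)) + (\<Sum>j<d. g (int N - int (Suc j)))"
proof (induction d)
  case (Suc d)
  define h where "h t = g (int t - int (Suc d))" for t
  have "(\<Sum>t<N. h (Suc t) - h t) = h N - h 0" by (rule sum_lessThan_telescope)
  moreover have "h (Suc t) = g (int t - int d)" for t by (simp add: h_def)
  ultimately have "(\<Sum>t<N. g (int t - int d)) = (\<Sum>t<N. h t) + h N - h 0"
    by (simp add: sum_subtractf)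
  then show ?case using Suc assms[of "- int (Suc d)"] by (simp add: h_def)
qed simp

context delay_noise
begin

abbreviation mean_square :: "('w \<Rightarrow> real^'k) \<Rightarrow> real" where
  "mean_square f \<equiv> expectation (\<lambda>w. f w \<bullet> f w)"

lemma mean_square_inner_le:
  assumes "L2_past t f"
  shows "expectation (\<lambda>w. (z \<bullet> f w)\<^sup>2) \<le> (z \<bullet> z) * mean_square f"
proof -
  have zf: "integrable M (\<lambda>w. (z \<bullet> f w)\<^sup>2)"
    using L2_past_inner(2)[OF assms L2_past_matrix[OF assms], of "\<chi> i j. z$i * z$j"]
    by (simp add: rank_one_quadratic)
  have "expectation (\<lambda>w. (z \<bullet> f w)\<^sup>2) \<le> expectation (\<lambda>w. (z \<bullet> z) * (f w \<bullet> f w))"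
    by (rule integral_mono[OF zf]) (use assms in \<open>auto simp: L2_past_def Cauchy_Schwarz_ineq\<close>)
  then show ?thesis by simp
qed

text \<open>Without subtracting means: these matrices collect raw second moments.\<close>

definition cross_moment :: "('w \<Rightarrow> real^'p) \<Rightarrow> ('w \<Rightarrow> real^'q) \<Rightarrow> real^'q^'p" where
  "cross_moment f g = (\<chi> i j. expectation (\<lambda>w. f w $ i * g w $ j))"

lemma cross_moment_form:
  assumes f: "L2_past t f" and g: "L2_past t g"
  shows "integrable M (\<lambda>w. (v \<bullet> f w) * (z \<bullet> g w))"
    and "v \<bullet> (cross_moment f g *v z) = expectation (\<lambda>w. (v \<bullet> f w) * (z \<bullet> g w))"
proof -
  have fg: "integrable M (\<lambda>w. f w $ i * g w $ j)" for i j
  proof -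
    define G :: "real^'b^'a" where "G = (\<chi> a b. if b = j then if a = i then 1 else 0 else 0)"
    have "G *v z = axis i (z $ j)" for z
      by (simp add: G_def vec_eq_iff matrix_vector_mult_def axis_def if_distrib[of "\<lambda>x. x * _"] cong: if_cong)
    then show ?thesis using L2_past_inner(2)[OF f L2_past_matrix[OF g, of G]] by (simp add: inner_axis)
  qed
  have expand: "(v \<bullet> f w) * (z \<bullet> g w) = (\<Sum>i\<in>UNIV. \<Sum>j\<in>UNIV. v$i * z$j * (f w $ i * g w $ j))" for w
    by (simp add: inner_vec_def sum_product mult_ac)
  show "integrable M (\<lambda>w. (v \<bullet> f w) * (z \<bullet> g w))"
    unfolding expand by (intro Bochner_Integration.integrable_sum integrable_mult_right fg)
  have "expectation (\<lambda>w. (v \<bullet> f w) * (z \<bullet> g w))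
      = (\<Sum>i\<in>UNIV. \<Sum>j\<in>UNIV. v$i * z$j * expectation (\<lambda>w. f w $ i * g w $ j))"
    unfolding expand by (simp add: fg Bochner_Integration.integrable_sum)
  then show "v \<bullet> (cross_moment f g *v z) = expectation (\<lambda>w. (v \<bullet> f w) * (z \<bullet> g w))"
    by (simp add: inner_vec_def matrix_vector_mult_def cross_moment_def sum_distrib_left mult_ac)
qed

lemma expectation_square_add:
  assumes f: "L2_past t f" and g: "L2_past t g"
  shows "expectation (\<lambda>w. (v \<bullet> f w + z \<bullet> g w)\<^sup>2)
    = v \<bullet> (cross_moment f f *v v) + 2 * (z \<bullet> (cross_moment g f *v v)) + z \<bullet> (cross_moment g g *v z)"
proof -
  have "(v \<bullet> f w + z \<bullet> g w)\<^sup>2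
      = (v \<bullet> f w) * (v \<bullet> f w) + 2 * ((z \<bullet> g w) * (v \<bullet> f w)) + (z \<bullet> g w) * (z \<bullet> g w)" for w
    by (simp add: power2_eq_square algebra_simps)
  then show ?thesis
    using cross_moment_form[OF f f, of v v] cross_moment_form[OF g f, of z v]
      cross_moment_form[OF g g, of z z] by simp
qed

text \<open>The dynamics shared by the predictor of the delayed system (\<open>d \<tau> = \<tau>\<close>) and the delay-free system
  (\<open>d \<tau> = 0\<close>). The control is not tied to \<open>\<beta>\<close>; it only has to be square integrable and
  determined by the past, including its values at the negative times that a delay can reach.\<close>

definition reduced_trajectory ::
  "real^'n^'n \<Rightarrow> real^'m^'n \<Rightarrow> (nat \<Rightarrow> real^'m^'n) \<Rightarrow> (nat \<Rightarrow> nat) \<Rightarrow>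
   (nat \<Rightarrow> 'w \<Rightarrow> real^'n) \<Rightarrow> (int \<Rightarrow> 'w \<Rightarrow> real^'m) \<Rightarrow> bool" where
  "reduced_trajectory A L E d \<beta> u \<longleftrightarrow>
     (\<forall>t. L2_past t (\<beta> t) \<and> (\<forall>j\<le>D. L2_past t (u (int t - int j)))) \<and>
     (\<forall>t. \<forall>w\<in>space M. \<beta> (Suc t) w =
        (A *v \<beta> t w + L *v u (int t) w) + (\<Sum>\<tau>\<le>D. \<omega> \<tau> t w *\<^sub>R (E \<tau> *v u (int t - int (d \<tau>)) w)))"

lemma reduced_second_moment:
  assumes "reduced_trajectory A L E d \<beta> u" and "\<forall>\<tau>\<le>D. d \<tau> \<le> D"
  shows "expectation (\<lambda>w. \<beta> (Suc t) w \<bullet> (P *v \<beta> (Suc t) w))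
     = expectation (\<lambda>w. (A *v \<beta> t w + L *v u (int t) w) \<bullet> (P *v (A *v \<beta> t w + L *v u (int t) w)))
       + (\<Sum>\<tau>\<le>D. (\<sigma> \<tau>)\<^sup>2 * expectation (\<lambda>w. (E \<tau> *v u (int t - int (d \<tau>)) w)
            \<bullet> (P *v (E \<tau> *v u (int t - int (d \<tau>)) w))))"
proof -
  have u: "L2_past t (u (int t - int j))" if "j \<le> D" for j
    using assms(1) that by (simp add: reduced_trajectory_def)
  have f: "L2_past t (\<lambda>w. A *v \<beta> t w + L *v u (int t) w)"
    using assms(1) u[of 0] by (auto simp: reduced_trajectory_def intro!: L2_past_add L2_past_matrix)
  have "expectation (\<lambda>w. \<beta> (Suc t) w \<bullet> (P *v \<beta> (Suc t) w)) = expectation (\<lambda>w.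
      (A *v \<beta> t w + L *v u (int t) w + (\<Sum>\<tau>\<le>D. \<omega> \<tau> t w *\<^sub>R (E \<tau> *v u (int t - int (d \<tau>)) w)))
      \<bullet> (P *v (A *v \<beta> t w + L *v u (int t) w + (\<Sum>\<tau>\<le>D. \<omega> \<tau> t w *\<^sub>R (E \<tau> *v u (int t - int (d \<tau>)) w)))))"
    by (rule Bochner_Integration.integral_cong[OF refl])
       (use assms(1) in \<open>simp add: reduced_trajectory_def\<close>)
  also have "\<dots> = expectation (\<lambda>w. (A *v \<beta> t w + L *v u (int t) w) \<bullet> (P *v (A *v \<beta> t w + L *v u (int t) w)))
       + (\<Sum>\<tau>\<le>D. (\<sigma> \<tau>)\<^sup>2 * expectation (\<lambda>w. (E \<tau> *v u (int t - int (d \<tau>)) w)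
            \<bullet> (P *v (E \<tau> *v u (int t - int (d \<tau>)) w))))"
    by (rule second_moment_step[OF f L2_past_matrix[OF u]]) (use assms(2) in simp)
  finally show ?thesis .
qed

text \<open>A control value \<open>u s\<close> enters through channel \<open>\<tau>\<close> at time \<open>s + d \<tau>\<close>. The Lyapunov functional \<open>V\<close> charges
  for it from time \<open>s + 1\<close> on until it has entered. So in one step the undelayed cost of \<open>u t\<close> replaces the cost of the
  value that enters, and \<open>V\<close> decreases exactly as it would for the delay-free system.\<close>

theorem summable_reduced_trajectory:
  fixes A :: "real^'n^'n" and L :: "real^'m^'n" and K :: "real^'n^'m"
  assumes traj: "reduced_trajectory A L E d \<beta> u" and d: "\<forall>\<tau>\<le>D. d \<tau> \<le> D"
    and feedback: "\<And>t w. w \<in> space M \<Longrightarrow> u (int t) w = K *v \<beta> t w"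
    and P: "posdef P" and H: "posdef (P - congr_sum {..Suc D} (closed_loop_gain \<sigma> A L E K) P)"
  shows "summable (\<lambda>t. mean_square (\<beta> t))"
proof -
  let ?T = "congr_sum {..Suc D} (closed_loop_gain \<sigma> A L E K) P"
  have L2: "L2_past t (\<beta> t)" for t using traj by (simp add: reduced_trajectory_def)
  have P_nonneg: "0 \<le> v \<bullet> (P *v v)" for v
    using P by (cases "v = 0") (auto simp: posdef_def intro: less_imp_le)
  define e where "e \<tau> s = expectation (\<lambda>w. (E \<tau> *v u s w) \<bullet> (P *v (E \<tau> *v u s w)))" for \<tau> s
  have e_nonneg: "0 \<le> e \<tau> s" for \<tau> s
    unfolding e_def by (intro Bochner_Integration.integral_nonneg P_nonneg)
  define p where "p t = expectation (\<lambda>w. \<beta> t w \<bullet> (P *v \<beta> t w))" for t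
  define V where "V t = p t + (\<Sum>\<tau>\<le>D. (\<sigma> \<tau>)\<^sup>2 * (\<Sum>s<d \<tau>. e \<tau> (int t - int (Suc s))))" for t
  have V_nonneg: "0 \<le> V t" for t
    unfolding V_def p_def
    by (intro add_nonneg_nonneg sum_nonneg mult_nonneg_nonneg e_nonneg
        Bochner_Integration.integral_nonneg P_nonneg) auto
  obtain h where h: "h > 0" "\<And>v. h * (v \<bullet> v) \<le> v \<bullet> ((P - ?T) *v v)"
    using posdef_ge[OF H] by blast
  have drop: "h * mean_square (\<beta> t) \<le> V t - V (Suc t)" for t
  proof -
    let ?f = "\<lambda>w. A *v \<beta> t w + L *v u (int t) w"
    have q: "integrable M (\<lambda>w. \<beta> t w \<bullet> (G *v \<beta> t w))" for G
      by (rule L2_past_inner(2)[OF L2 L2_past_matrix[OF L2]])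
    \<comment> \<open>The window of pending controls moves by one: the value that enters leaves it and \<open>u t\<close> joins.\<close>
    have window: "e \<tau> (int t - int (d \<tau>)) + (\<Sum>s<d \<tau>. e \<tau> (int (Suc t) - int (Suc s)))
        = e \<tau> (int t) + (\<Sum>s<d \<tau>. e \<tau> (int t - int (Suc s)))" for \<tau>
    proof -
      have "(\<Sum>s<Suc (d \<tau>). e \<tau> (int t - int s)) = e \<tau> (int t) + (\<Sum>s<d \<tau>. e \<tau> (int t - int (Suc s)))"
        by (subst sum.lessThan_Suc_shift) simp
      then show ?thesis by simp
    qed
    have "V (Suc t) = expectation (\<lambda>w. ?f w \<bullet> (P *v ?f w))
       + (\<Sum>\<tau>\<le>D. (\<sigma> \<tau>)\<^sup>2 * (e \<tau> (int t - int (d \<tau>)) + (\<Sum>s<d \<tau>. e \<tau> (int (Suc t) - int (Suc s)))))"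
      unfolding V_def p_def reduced_second_moment[OF traj d]
      by (simp only: e_def distrib_left sum.distrib add.assoc)
    also have "\<dots> = (V t - p t) + (expectation (\<lambda>w. ?f w \<bullet> (P *v ?f w)) + (\<Sum>\<tau>\<le>D. (\<sigma> \<tau>)\<^sup>2 * e \<tau> (int t)))"
      unfolding window V_def by (simp add: distrib_left sum.distrib)
    also have "expectation (\<lambda>w. ?f w \<bullet> (P *v ?f w)) + (\<Sum>\<tau>\<le>D. (\<sigma> \<tau>)\<^sup>2 * e \<tau> (int t))
        = expectation (\<lambda>w. \<beta> t w \<bullet> (?T *v \<beta> t w))"
    proof -
      have "expectation (\<lambda>w. ?f w \<bullet> (P *v ?f w))
          = expectation (\<lambda>w. ((A + L ** K) *v \<beta> t w) \<bullet> (P *v ((A + L ** K) *v \<beta> t w)))"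
        by (rule Bochner_Integration.integral_cong)
           (auto simp: feedback matrix_vector_mul_assoc[symmetric] matrix_vector_mult_add_rdistrib)
      moreover have "e \<tau> (int t)
          = expectation (\<lambda>w. (E \<tau> *v (K *v \<beta> t w)) \<bullet> (P *v (E \<tau> *v (K *v \<beta> t w))))" for \<tau>
        unfolding e_def by (rule Bochner_Integration.integral_cong) (auto simp: feedback)
      moreover have "integrable M (\<lambda>w. (G *v \<beta> t w) \<bullet> (P *v (G *v \<beta> t w)))" for G :: "real^'n^'n"
        by (intro L2_past_inner(2)[where t = t] L2_past_matrix L2)
      moreover have "integrable M (\<lambda>w. (E \<tau> *v (K *v \<beta> t w)) \<bullet> (P *v (E \<tau> *v (K *v \<beta> t w))))" for \<tau>
        by (intro L2_past_inner(2)[where t = t] L2_past_matrix L2)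
      ultimately show ?thesis
        unfolding quadratic_closed_loop by simp
    qed
    finally have "V t - V (Suc t) = expectation (\<lambda>w. \<beta> t w \<bullet> ((P - ?T) *v \<beta> t w))"
      using q by (simp add: p_def matrix_vector_mult_diff_rdistrib inner_diff_right)
    moreover have "expectation (\<lambda>w. h * (\<beta> t w \<bullet> \<beta> t w)) \<le> expectation (\<lambda>w. \<beta> t w \<bullet> ((P - ?T) *v \<beta> t w))"
      by (intro integral_mono h(2) q) (use L2[of t] in \<open>simp add: L2_past_def\<close>)
    ultimately show ?thesis by simp
  qed
  have "(\<Sum>t<N. mean_square (\<beta> t)) \<le> V 0 / h" for N
  proof -
    have "h * (\<Sum>t<N. mean_square (\<beta> t)) \<le> (\<Sum>t<N. V t - V (Suc t))"
      unfolding sum_distrib_left by (intro sum_mono drop)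
    also have "\<dots> = V 0 - V N" by (rule sum_lessThan_telescope')
    also have "\<dots> \<le> V 0" using V_nonneg by simp
    finally show ?thesis using h(1) by (simp add: field_simps)
  qed
  then show ?thesis
    by (intro summableI_nonneg_bounded Bochner_Integration.integral_nonneg inner_ge_zero)
qed

text \<open>Summing the second moment equation over \<open>t < N\<close> and over the starts at the basis vectors gives the dual
  Lyapunov inequality for the summed moment matrix \<open>X\<close>. The starts contribute the identity, and what is
  lost at the end, namely the moments of \<open>\<beta> N\<close> and of the controls still pending at time \<open>N\<close>, tends to zero,
  so a finite horizon is enough.\<close>

theorem reduced_null_imp_lyapunov:
  fixes A :: "real^'n^'n" and L :: "real^'m^'n" and \<beta> :: "'n \<Rightarrow> nat \<Rightarrow> 'w \<Rightarrow> real^'n"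
  assumes traj: "\<And>i. reduced_trajectory A L E d (\<beta> i) (u i)" and d: "\<forall>\<tau>\<le>D. d \<tau> \<le> D"
    and init: "\<And>i w. w \<in> space M \<Longrightarrow> \<beta> i 0 w = axis i 1"
    and \<beta>_null: "\<And>i. (\<lambda>t. mean_square (\<beta> i t)) \<longlonglongrightarrow> 0"
    and u_null: "\<And>i. (\<lambda>t. mean_square (u i (int t))) \<longlonglongrightarrow> 0"
  shows "\<exists>K P. posdef P \<and> posdef (P - congr_sum {..Suc D} (closed_loop_gain \<sigma> A L E K) P)"
proof -
  have L2\<beta>: "L2_past t (\<beta> i t)" for i t using traj[of i] by (simp add: reduced_trajectory_def)
  have L2u: "L2_past t (u i (int t - int j))" if "j \<le> D" for i t j
    using traj[of i] that by (simp add: reduced_trajectory_def)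
  have L2u0: "L2_past t (u i (int t))" for i t using L2u[of 0 t i] by simp
  have "\<exists>\<kappa>>0. \<forall>v. (transpose (E \<tau>) *v v) \<bullet> (transpose (E \<tau>) *v v) \<le> \<kappa> * (v \<bullet> v)" for \<tau>
    by (rule matrix_vector_mult_inner_bound[of "transpose (E \<tau>)"]) blast
  then obtain k where k: "\<And>\<tau> v. (transpose (E \<tau>) *v v) \<bullet> (transpose (E \<tau>) *v v) \<le> k \<tau> * (v \<bullet> v)"
    and k_pos: "\<And>\<tau>. 0 < k \<tau>" by metis
  \<comment> \<open>\<open>tail N * (v \<bullet> v)\<close> bounds the boundary terms at time \<open>N\<close> in direction \<open>v\<close>.\<close>
  define \<kappa> where "\<kappa> = (\<Sum>\<tau>\<le>D. (\<sigma> \<tau>)\<^sup>2 * k \<tau>)"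
  define tail where "tail N = (\<Sum>i\<in>UNIV. mean_square (\<beta> i N))
    + \<kappa> * (\<Sum>i\<in>UNIV. \<Sum>j<D. mean_square (u i (int N - int (Suc j))))" for N
  have "tail \<longlonglongrightarrow> 0"
  proof -
    have "(\<lambda>N. mean_square (u i (int N - int (Suc j)))) \<longlonglongrightarrow> 0" for i j
      by (rule LIMSEQ_offset[of _ "Suc j"]) (simp add: u_null algebra_simps)
    then have "tail \<longlonglongrightarrow> (\<Sum>i\<in>(UNIV::'n set). 0) + \<kappa> * (\<Sum>i\<in>(UNIV::'n set). \<Sum>j<D. 0)"
      unfolding tail_def by (intro tendsto_intros \<beta>_null)
    then show ?thesis by simp
  qed
  then have "eventually (\<lambda>N. tail N < 1/2) sequentially" by (rule order_tendstoD) simp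
  then obtain N where N: "N > 0" "tail N \<le> 1/2"
    using eventually_happens[OF eventually_conj[OF _ eventually_gt_at_top[of 0]]]
    by (metis less_imp_le sequentially_bot)

  define X where "X = (\<Sum>i\<in>UNIV. \<Sum>t<N. cross_moment (\<beta> i t) (\<beta> i t))"
  define Y where "Y = (\<Sum>i\<in>UNIV. \<Sum>t<N. cross_moment (u i (int t)) (\<beta> i t))"
  define U where "U = (\<Sum>i\<in>UNIV. \<Sum>t<N. cross_moment (u i (int t)) (u i (int t)))"
  define q where "q v z = (\<Sum>i\<in>UNIV. \<Sum>t<N. expectation (\<lambda>w. (v \<bullet> \<beta> i t w + z \<bullet> u i (int t) w)\<^sup>2))" for v z
  have q_eq: "q v z = v \<bullet> (X *v v) + 2 * (z \<bullet> (Y *v v)) + z \<bullet> (U *v z)" for v z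
    unfolding q_def X_def Y_def U_def expectation_square_add[OF L2\<beta> L2u0]
    by (simp add: sum_matrix_vector_mult inner_sum_right sum.distrib sum_distrib_left)
  have q_nonneg: "0 \<le> q v z" for v z
    unfolding q_def by (intro sum_nonneg Bochner_Integration.integral_nonneg) simp
  have X_eq: "v \<bullet> (X *v v) = (\<Sum>i\<in>UNIV. \<Sum>t<N. expectation (\<lambda>w. (v \<bullet> \<beta> i t w)\<^sup>2))" for v
    using q_eq[of v 0] by (simp add: q_def)
  have init_sum: "(\<Sum>i\<in>UNIV. expectation (\<lambda>w. (v \<bullet> \<beta> i 0 w)\<^sup>2)) = v \<bullet> v" for v
  proof -
    have "expectation (\<lambda>w. (v \<bullet> \<beta> i 0 w)\<^sup>2) = expectation (\<lambda>w. (v $ i)\<^sup>2)" for i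
      by (rule Bochner_Integration.integral_cong) (simp_all add: init inner_axis)
    then show ?thesis by (simp add: prob_space inner_vec_def power2_eq_square)
  qed
  have "posdef X"
  proof -
    have "transpose X = X"
      by (simp add: X_def transpose_sum) (simp add: cross_moment_def transpose_def mult.commute)
    moreover have "v \<bullet> v \<le> v \<bullet> (X *v v)" for v
      unfolding X_eq init_sum[of v, symmetric]
      by (intro sum_mono member_le_sum) (use N(1) in \<open>auto intro: Bochner_Integration.integral_nonneg\<close>)
    then have "0 < v \<bullet> (X *v v)" if "v \<noteq> 0" for v
      using that less_le_trans[of 0 "v \<bullet> v"] by simp
    ultimately show ?thesis by (simp add: posdef_def)
  qed
  then obtain K where K: "\<And>v z. (v + transpose K *v z) \<bullet> (X *v (v + transpose K *v z)) \<le> q v z"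
    using schur_complement[of X Y U] q_nonneg unfolding q_eq by blast

  \<comment> \<open>The summed second moment equation, tested with \<open>v v'\<close>.\<close>
  have energy: "q (transpose A *v v) (transpose L *v v) + (\<Sum>\<tau>\<le>D. (\<sigma> \<tau>)\<^sup>2 * q 0 (transpose (E \<tau>) *v v))
      \<le> v \<bullet> (X *v v) - v \<bullet> v + tail N * (v \<bullet> v)" for v
  proof -
    let ?z = "\<lambda>\<tau>. transpose (E \<tau>) *v v"
    define g where "g \<tau> i s = expectation (\<lambda>w. (?z \<tau> \<bullet> u i s w)\<^sup>2)" for \<tau> i s
    define b where "b i t = expectation (\<lambda>w. (v \<bullet> \<beta> i t w)\<^sup>2)" for i t
    define f where "f i t = expectation (\<lambda>w. ((transpose A *v v) \<bullet> \<beta> i t w + (transpose L *v v) \<bullet> u i (int t) w)\<^sup>2)"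
      for i t
    have step: "b i (Suc t) = f i t + (\<Sum>\<tau>\<le>D. (\<sigma> \<tau>)\<^sup>2 * g \<tau> i (int t - int (d \<tau>)))" for i t
      using reduced_second_moment[OF traj[of i] d, where P = "\<chi> i j. v$i * v$j" and t = t]
      by (simp add: rank_one_quadratic b_def f_def g_def inner_add_right
          inner_mult_eq_transpose[of v A] inner_mult_eq_transpose[of v L] inner_mult_eq_transpose[of v "E _"])
    have delayed: "(\<Sum>t<N. g \<tau> i (int t)) \<le> (\<Sum>t<N. g \<tau> i (int t - int (d \<tau>)))
        + k \<tau> * (v \<bullet> v) * (\<Sum>j<D. mean_square (u i (int N - int (Suc j))))" if "\<tau> \<le> D" for \<tau> i
    proof -
      have g_le: "g \<tau> i (int N - int (Suc j)) \<le> k \<tau> * (v \<bullet> v) * mean_square (u i (int N - int (Suc j)))"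
        if "j < D" for j
      proof -
        have "g \<tau> i (int N - int (Suc j)) \<le> (?z \<tau> \<bullet> ?z \<tau>) * mean_square (u i (int N - int (Suc j)))"
          unfolding g_def by (rule mean_square_inner_le[OF L2u]) (use that in simp)
        also have "\<dots> \<le> k \<tau> * (v \<bullet> v) * mean_square (u i (int N - int (Suc j)))"
          by (intro mult_right_mono k Bochner_Integration.integral_nonneg) simp
        finally show ?thesis .
      qed
      have g_nonneg: "0 \<le> g \<tau> i s" for s
        unfolding g_def by (rule Bochner_Integration.integral_nonneg) simp
      have "(\<Sum>t<N. g \<tau> i (int t)) \<le> (\<Sum>t<N. g \<tau> i (int t - int (d \<tau>))) + (\<Sum>j<d \<tau>. g \<tau> i (int N - int (Suc j)))"
        by (rule sum_lessThan_shift_le) (rule g_nonneg)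
      also have "(\<Sum>j<d \<tau>. g \<tau> i (int N - int (Suc j))) \<le> (\<Sum>j<D. g \<tau> i (int N - int (Suc j)))"
        by (rule sum_mono2) (use d that g_nonneg in auto)
      also have "\<dots> \<le> (\<Sum>j<D. k \<tau> * (v \<bullet> v) * mean_square (u i (int N - int (Suc j))))"
        by (rule sum_mono) (use g_le in simp)
      finally show ?thesis by (simp add: sum_distrib_left)
    qed
    have one: "(\<Sum>t<N. f i t) + (\<Sum>\<tau>\<le>D. (\<sigma> \<tau>)\<^sup>2 * (\<Sum>t<N. g \<tau> i (int t)))
       \<le> (\<Sum>t<N. b i t) - b i 0 + (v \<bullet> v) * (mean_square (\<beta> i N)
            + \<kappa> * (\<Sum>j<D. mean_square (u i (int N - int (Suc j)))))" for i
    proof -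
      let ?r = "\<Sum>j<D. mean_square (u i (int N - int (Suc j)))"
      have "(\<Sum>\<tau>\<le>D. (\<sigma> \<tau>)\<^sup>2 * (\<Sum>t<N. g \<tau> i (int t)))
          \<le> (\<Sum>\<tau>\<le>D. (\<sigma> \<tau>)\<^sup>2 * ((\<Sum>t<N. g \<tau> i (int t - int (d \<tau>))) + k \<tau> * (v \<bullet> v) * ?r))"
        by (intro sum_mono mult_left_mono delayed) auto
      also have "\<dots> = (\<Sum>\<tau>\<le>D. \<Sum>t<N. (\<sigma> \<tau>)\<^sup>2 * g \<tau> i (int t - int (d \<tau>))) + \<kappa> * (v \<bullet> v) * ?r"
      proof -
        have \<kappa>_sum: "(\<Sum>\<tau>\<le>D. (\<sigma> \<tau>)\<^sup>2 * (k \<tau> * (v \<bullet> v) * r)) = \<kappa> * (v \<bullet> v) * r" for r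
          by (simp add: \<kappa>_def sum_distrib_right mult.assoc)
        show ?thesis
          unfolding distrib_left sum.distrib \<kappa>_sum by (simp add: sum_distrib_left[where A = "{..<N}"])
      qed
      also have "(\<Sum>\<tau>\<le>D. \<Sum>t<N. (\<sigma> \<tau>)\<^sup>2 * g \<tau> i (int t - int (d \<tau>))) = (\<Sum>t<N. b i (Suc t) - f i t)"
        unfolding step by (subst sum.swap) simp
      also have "\<dots> = (\<Sum>t<N. b i (Suc t) - b i t) + (\<Sum>t<N. b i t) - (\<Sum>t<N. f i t)"
        by (simp add: sum_subtractf)
      also have "(\<Sum>t<N. b i (Suc t) - b i t) = b i N - b i 0" by (rule sum_lessThan_telescope)
      finally have "(\<Sum>t<N. f i t) + (\<Sum>\<tau>\<le>D. (\<sigma> \<tau>)\<^sup>2 * (\<Sum>t<N. g \<tau> i (int t)))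
          \<le> (\<Sum>t<N. b i t) - b i 0 + b i N + \<kappa> * (v \<bullet> v) * ?r" by simp
      moreover have "b i N \<le> (v \<bullet> v) * mean_square (\<beta> i N)"
        unfolding b_def by (rule mean_square_inner_le[OF L2\<beta>])
      ultimately show ?thesis by (simp add: algebra_simps)
    qed
    have "q (transpose A *v v) (transpose L *v v) + (\<Sum>\<tau>\<le>D. (\<sigma> \<tau>)\<^sup>2 * q 0 (?z \<tau>))
        = (\<Sum>i\<in>UNIV. (\<Sum>t<N. f i t) + (\<Sum>\<tau>\<le>D. (\<sigma> \<tau>)\<^sup>2 * (\<Sum>t<N. g \<tau> i (int t))))"
      by (simp add: q_def f_def g_def sum.distrib sum_distrib_left) (rule sum.swap)
    also have "\<dots> \<le> (\<Sum>i\<in>UNIV. (\<Sum>t<N. b i t) - b i 0 + (v \<bullet> v) * (mean_square (\<beta> i N)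
            + \<kappa> * (\<Sum>j<D. mean_square (u i (int N - int (Suc j))))))"
      by (rule sum_mono) (rule one)
    also have "\<dots> = v \<bullet> (X *v v) - v \<bullet> v + tail N * (v \<bullet> v)"
      unfolding X_eq tail_def b_def
      by (simp add: init_sum sum.distrib sum_subtractf sum_distrib_left sum_distrib_right algebra_simps)
    finally show ?thesis .
  qed
  have "1/2 * (v \<bullet> v) + (\<Sum>j\<le>Suc D. (transpose (closed_loop_gain \<sigma> A L E K j) *v v)
        \<bullet> (X *v (transpose (closed_loop_gain \<sigma> A L E K j) *v v))) \<le> v \<bullet> (X *v v)" for v
  proof -
    have "tail N * (v \<bullet> v) \<le> 1/2 * (v \<bullet> v)" by (intro mult_right_mono N) simp
    moreover have "(\<Sum>j\<le>Suc D. (transpose (closed_loop_gain \<sigma> A L E K j) *v v)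
        \<bullet> (X *v (transpose (closed_loop_gain \<sigma> A L E K j) *v v)))
      \<le> q (transpose A *v v) (transpose L *v v) + (\<Sum>\<tau>\<le>D. (\<sigma> \<tau>)\<^sup>2 * q 0 (transpose (E \<tau>) *v v))"
      unfolding quadratic_closed_loop_dual
      using K[of 0] by (intro add_mono K sum_mono mult_left_mono) simp_all
    ultimately show ?thesis using energy[of v] by simp
  qed
  moreover have "0 \<le> v \<bullet> (X *v v)" for v
    using \<open>posdef X\<close> by (cases "v = 0") (auto simp: posdef_def intro: less_imp_le)
  ultimately show ?thesis
    using dual_lyapunov_inequality[where X = X and \<epsilon> = "1/2" and J = "{..Suc D}"
        and G = "closed_loop_gain \<sigma> A L E K"] by auto
qed

end

section \<open>The predictor of the delayed system\<close>

text \<open>The weight of \<open>u (t - 1 - i)\<close> in the predictor: this control still enters the drift through the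
  channels \<open>\<tau> > i\<close>, in the step from time \<open>t - 1 - i + \<tau>\<close>, and is then propagated by \<open>A\<close> up to time \<open>t + D\<close>.\<close>

definition predictor_gain :: "nat \<Rightarrow> real^'n^'n \<Rightarrow> (nat \<Rightarrow> real^'m^'n) \<Rightarrow> nat \<Rightarrow> real^'m^'n" where
  "predictor_gain D A B i = (\<Sum>\<tau>\<in>{Suc i..D}. matpow A (D + i - \<tau>) ** B \<tau>)"

text \<open>The conditional mean of \<open>x (t + D)\<close> given the past of \<open>t\<close> if the controls from time \<open>t\<close> on are zero.\<close>

definition predictor ::
  "nat \<Rightarrow> real^'n^'n \<Rightarrow> (nat \<Rightarrow> real^'m^'n) \<Rightarrow> (nat \<Rightarrow> 'w \<Rightarrow> real^'n) \<Rightarrow> (int \<Rightarrow> 'w \<Rightarrow> real^'m)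
     \<Rightarrow> nat \<Rightarrow> 'w \<Rightarrow> real^'n" where
  "predictor D A B x u t w = matpow A D *v x t w
     + (\<Sum>i<D. predictor_gain D A B i *v u (int t - int (Suc i)) w)"

lemma predictor_gain_shift:
  assumes "i < D"
  shows "A ** predictor_gain D A B i = matpow A D ** B (Suc i) + predictor_gain D A B (Suc i)"
proof -
  have "A ** predictor_gain D A B i = (\<Sum>\<tau>\<in>{Suc i..D}. matpow A (D + Suc i - \<tau>) ** B \<tau>)"
    unfolding predictor_gain_def matrix_mult_sum_right
  proof (rule sum.cong[OF refl])
    fix \<tau> assume "\<tau> \<in> {Suc i..D}"
    then have "D + Suc i - \<tau> = Suc (D + i - \<tau>)" by (simp add: Suc_diff_le)
    then show "A ** (matpow A (D + i - \<tau>) ** B \<tau>) = matpow A (D + Suc i - \<tau>) ** B \<tau>"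
      by (simp add: matrix_mul_assoc)
  qed
  also have "\<dots> = matpow A D ** B (Suc i) + (\<Sum>\<tau>\<in>{Suc (Suc i)..D}. matpow A (D + Suc i - \<tau>) ** B \<tau>)"
    using assms by (subst sum.atLeast_Suc_atMost) simp_all
  finally show ?thesis by (simp add: predictor_gain_def)
qed

lemma input_gain_eq:
  "(\<Sum>j\<le>D. matpow A (D - j) ** B j) = matpow A D ** B 0 + predictor_gain D A B 0"
  unfolding predictor_gain_def atMost_atLeast0
  by (subst sum.atLeast_Suc_atMost) simp_all

text \<open>Advancing the predictor moves every past control one place further into the past, which by
  \<open>predictor_gain_shift\<close> is matched by one factor \<open>A\<close>. Only the fresh control \<open>u t\<close> is left over in the drift,
  and its total weight is \<open>L\<close>.\<close>

lemma predictor_step: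
  assumes "delayed_system M D \<omega> A B C x u" and "w \<in> space M"
    and L: "L = (\<Sum>j\<le>D. matpow A (D - j) ** B j)"
  shows "predictor D A B x u (Suc t) w = (A *v predictor D A B x u t w + L *v u (int t) w)
     + (\<Sum>\<tau>\<le>D. \<omega> \<tau> t w *\<^sub>R ((matpow A D ** C \<tau>) *v u (int t - int \<tau>) w))"
proof -
  let ?R = "predictor_gain D A B" and ?u = "\<lambda>i. u (int t - int i) w"
  have x: "x (Suc t) w = A *v x t w + (\<Sum>\<tau>\<le>D. B \<tau> *v ?u \<tau>) + (\<Sum>\<tau>\<le>D. \<omega> \<tau> t w *\<^sub>R (C \<tau> *v ?u \<tau>))"
    using assms(1,2) by (simp add: delayed_system_def matrix_vector_mult_add_rdistrib sum.distrib
        scaleR_matrix_vector_assoc[symmetric])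
  \<comment> \<open>A control from time \<open>t - 1 - D\<close> has already entered through every channel.\<close>
  have "?R D = 0" by (simp add: predictor_gain_def)
  then have "(\<Sum>\<tau>\<le>D. (matpow A D ** B \<tau>) *v ?u \<tau>) + (\<Sum>i<D. ?R i *v ?u i)
      = (\<Sum>i\<le>D. (matpow A D ** B i + ?R i) *v ?u i)"
    by (simp add: matrix_vector_mult_add_rdistrib sum.distrib lessThan_Suc_atMost[symmetric])
  also have "\<dots> = L *v u (int t) w + (\<Sum>i<D. (matpow A D ** B (Suc i) + ?R (Suc i)) *v ?u (Suc i))"
  proof -
    have "L = matpow A D ** B 0 + ?R 0" unfolding L by (rule input_gain_eq)
    then show ?thesis unfolding sum.atMost_shift by simp
  qed
  also have "\<dots> = L *v u (int t) w + A *v (\<Sum>i<D. ?R i *v ?u (Suc i))"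
    by (simp add: predictor_gain_shift[symmetric] matrix_vector_mult_sum_right matrix_vector_mul_assoc)
  finally have controls: "(\<Sum>\<tau>\<le>D. (matpow A D ** B \<tau>) *v ?u \<tau>) + (\<Sum>i<D. ?R i *v ?u i)
     = L *v u (int t) w + A *v (\<Sum>i<D. ?R i *v ?u (Suc i))" .
  have "predictor D A B x u (Suc t) w = matpow A D *v x (Suc t) w + (\<Sum>i<D. ?R i *v ?u i)"
    by (simp add: predictor_def)
  also have "\<dots> = matpow A D *v (A *v x t w)
      + ((\<Sum>\<tau>\<le>D. (matpow A D ** B \<tau>) *v ?u \<tau>) + (\<Sum>i<D. ?R i *v ?u i))
      + (\<Sum>\<tau>\<le>D. \<omega> \<tau> t w *\<^sub>R ((matpow A D ** C \<tau>) *v ?u \<tau>))"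
    unfolding x by (simp add: matrix_vector_right_distrib matrix_vector_mult_sum_right
        matrix_vector_mult_scaleR matrix_vector_mul_assoc)
  also have "matpow A D *v (A *v x t w) = A *v (matpow A D *v x t w)"
    by (simp add: matrix_vector_mul_assoc matpow_comm)
  finally show ?thesis
    unfolding controls by (simp add: predictor_def matrix_vector_right_distrib algebra_simps)
qed

context delay_noise
begin

definition null_process :: "(nat \<Rightarrow> 'w \<Rightarrow> real^'k) \<Rightarrow> bool" where
  "null_process f \<longleftrightarrow> (\<forall>t. L2_past t (f t)) \<and> (\<lambda>t. mean_square (f t)) \<longlonglongrightarrow> 0"

lemma null_process_if_dominated:
  assumes "\<And>t. L2_past t (f t)" and "g \<longlonglongrightarrow> 0" and "\<And>t. mean_square (f t) \<le> g t"
  shows "null_process f"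
  unfolding null_process_def
  by (intro conjI allI assms(1) tendsto_sandwich[OF _ _ tendsto_const assms(2)] always_eventually assms(3)
      Bochner_Integration.integral_nonneg inner_ge_zero)

lemma null_process_matrix:
  assumes "null_process f"
  shows "null_process (\<lambda>t w. G *v f t w)"
proof -
  obtain c where c: "c > 0" "\<And>v. (G *v v) \<bullet> (G *v v) \<le> c * (v \<bullet> v)"
    by (rule matrix_vector_mult_inner_bound[of G]) blast
  have f: "L2_past t (f t)" for t using assms by (simp add: null_process_def)
  show ?thesis
  proof (rule null_process_if_dominated)
    show "L2_past t (\<lambda>w. G *v f t w)" for t by (rule L2_past_matrix[OF f])
    show "(\<lambda>t. c * mean_square (f t)) \<longlonglongrightarrow> 0"
      using assms by (auto simp: null_process_def intro: tendsto_mult_right_zero)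
    have "mean_square (\<lambda>w. G *v f t w) \<le> expectation (\<lambda>w. c * (f t w \<bullet> f t w))" for t
      by (intro integral_mono c(2))
         (use f[of t] L2_past_matrix[OF f[of t], of G] in \<open>simp_all add: L2_past_def\<close>)
    then show "mean_square (\<lambda>w. G *v f t w) \<le> c * mean_square (f t)" for t by simp
  qed
qed

lemma null_process_add:
  assumes "null_process f" "null_process g"
  shows "null_process (\<lambda>t w. f t w + g t w)"
proof -
  have fg: "L2_past t (f t)" "L2_past t (g t)" for t using assms by (simp_all add: null_process_def)
  show ?thesis
  proof (rule null_process_if_dominated)
    show "L2_past t (\<lambda>w. f t w + g t w)" for t by (rule L2_past_add[OF fg])
    have "(\<lambda>t. 2 * mean_square (f t) + 2 * mean_square (g t)) \<longlonglongrightarrow> 2 * 0 + 2 * 0"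
      using assms by (intro tendsto_intros) (simp_all add: null_process_def)
    then show "(\<lambda>t. 2 * mean_square (f t) + 2 * mean_square (g t)) \<longlonglongrightarrow> 0" by simp
    have le: "mean_square (\<lambda>w. f t w + g t w) \<le> expectation (\<lambda>w. 2 * (f t w \<bullet> f t w) + 2 * (g t w \<bullet> g t w))" for t
      by (intro integral_mono inner_add_le)
         (use fg[of t] L2_past_add[OF fg, of t] in \<open>simp_all add: L2_past_def\<close>)
    show "mean_square (\<lambda>w. f t w + g t w) \<le> 2 * mean_square (f t) + 2 * mean_square (g t)" for t
      using le[of t] fg[of t] by (simp add: L2_past_def)
  qed
qed

lemma null_process_sum:
  "(\<And>i. i \<in> I \<Longrightarrow> null_process (f i)) \<Longrightarrow> null_process (\<lambda>t w. \<Sum>i\<in>I. f i t w)"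
  by (induction I rule: infinite_finite_induct) (simp_all add: null_process_add, simp_all add: null_process_def)

lemma null_process_delay:
  assumes "\<And>t. L2_past t (u (int t - int j))" and "(\<lambda>t. mean_square (u (int t))) \<longlonglongrightarrow> 0"
  shows "null_process (\<lambda>t. u (int t - int j))"
proof -
  have "(\<lambda>t. mean_square (u (int t - int j))) \<longlonglongrightarrow> 0"
    by (rule LIMSEQ_offset[of _ j]) (simp add: assms(2))
  then show ?thesis using assms(1) by (simp add: null_process_def)
qed

text \<open>Admissibility alone makes \<open>u t\<close> measurable for the noise up to and including time \<open>t\<close>, which is not enough for
  independence of the noise at time \<open>t\<close>; the closed-loop recursion gives the stronger property.\<close>

lemma L2_past_closed_loop:
  assumes init: "initial_data M D x0 u0 x u" and sys: "delayed_system M D \<omega> A B C x u"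
    and fb: "feedback_law M D K0 K x u"
  shows "L2_past t (x t) \<and> (\<forall>j\<le>D. L2_past t (u (int t - int j)))"
proof (induction t)
  have control: "\<forall>j\<le>D. L2_past t (u (int t - int j))"
    if x: "L2_past t (x t)" and u: "\<forall>j\<in>{1..D}. L2_past t (u (int t - int j))" for t
  proof -
    have "L2_past t (\<lambda>w. K0 *v x t w + (\<Sum>\<tau>=1..D. K \<tau> *v u (int t - int \<tau>) w))"
      using x u by (intro L2_past_add L2_past_sum L2_past_matrix) auto
    moreover have "L2_past t (u (int t)) \<longleftrightarrow>
        L2_past t (\<lambda>w. K0 *v x t w + (\<Sum>\<tau>=1..D. K \<tau> *v u (int t - int \<tau>) w))"
      by (rule L2_past_cong) (use fb in \<open>simp add: feedback_law_def\<close>)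
    ultimately have "L2_past t (u (int t))" by simp
    then show ?thesis using u by (auto simp: Suc_le_eq) 
  qed
  {
    case 0
    have "L2_past 0 (x 0)"
      using L2_past_cong[of "x 0" "\<lambda>_. x0" 0] init by (simp add: initial_data_def)
    moreover have "L2_past 0 (u (int 0 - int j))" if "j \<in> {1..D}" for j
      using L2_past_cong[of "u (- int j)" "\<lambda>_. u0 (- int j)" 0] init that
      by (simp add: initial_data_def)
    ultimately show ?case using control[of 0] by simp
  next
    case (Suc t)
    then have x: "L2_past t (x t)" and u: "\<And>j. j \<le> D \<Longrightarrow> L2_past t (u (int t - int j))" by auto
    have "L2_past (Suc t) (\<lambda>w. (A *v x t w + (\<Sum>\<tau>\<le>D. B \<tau> *v u (int t - int \<tau>) w))
        + (\<Sum>\<tau>\<le>D. \<omega> \<tau> t w *\<^sub>R (C \<tau> *v u (int t - int \<tau>) w)))"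
      by (intro L2_past_add L2_past_sum L2_past_noise L2_past_mono[of t _ "Suc t"] L2_past_matrix x u)
         simp_all
    moreover have "L2_past (Suc t) (x (Suc t)) \<longleftrightarrow>
       L2_past (Suc t) (\<lambda>w. (A *v x t w + (\<Sum>\<tau>\<le>D. B \<tau> *v u (int t - int \<tau>) w))
        + (\<Sum>\<tau>\<le>D. \<omega> \<tau> t w *\<^sub>R (C \<tau> *v u (int t - int \<tau>) w)))"
      by (rule L2_past_cong) (use sys in \<open>simp add: delayed_system_def matrix_vector_mult_add_rdistrib
         sum.distrib scaleR_matrix_vector_assoc[symmetric]\<close>)
    ultimately have "L2_past (Suc t) (x (Suc t))" by simp
    moreover have "L2_past (Suc t) (u (int (Suc t) - int j))" if "j \<in> {1..D}" for j
    proof -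
      have "int (Suc t) - int j = int t - int (j - 1)" using that by (simp add: of_nat_diff)
      moreover have "L2_past (Suc t) (u (int t - int (j - 1)))"
        by (rule L2_past_mono[OF u]) (use that in auto)
      ultimately show ?thesis by (simp only:)
    qed
    ultimately show ?case using control[of "Suc t"] by simp
  }
qed

lemma reduced_trajectory_predictor:
  assumes "initial_data M D x0 u0 x u" and sys: "delayed_system M D \<omega> A B C x u"
    and "feedback_law M D K0 K x u" and L: "L = (\<Sum>j\<le>D. matpow A (D - j) ** B j)"
  shows "reduced_trajectory A L (\<lambda>\<tau>. matpow A D ** C \<tau>) (\<lambda>\<tau>. \<tau>) (predictor D A B x u) u"
proof -
  note L2 = L2_past_closed_loop[OF assms(1-3)]
  have "L2_past t (predictor D A B x u t)" for t
    unfolding predictor_def using L2[of t]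
    by (intro L2_past_add L2_past_sum L2_past_matrix) (auto simp: Suc_le_eq simp del: of_nat_Suc)
  then show ?thesis
    unfolding reduced_trajectory_def using L2 predictor_step[OF sys _ L] by blast
qed

lemma reduced_trajectory_delay_free:
  assumes init: "\<And>w. w \<in> space M \<Longrightarrow> \<beta> 0 w = \<beta>0" and loop: "delay_free_closed_loop M D \<omega> A L C K \<beta>"
  shows "reduced_trajectory A L (\<lambda>\<tau>. matpow A D ** C \<tau>) (\<lambda>_. 0) \<beta> (\<lambda>s w. if s < 0 then 0 else K *v \<beta> (nat s) w)"
proof -
  have step: "\<beta> (Suc t) w = (A *v \<beta> t w + L *v (K *v \<beta> t w))
      + (\<Sum>\<tau>\<le>D. \<omega> \<tau> t w *\<^sub>R ((matpow A D ** C \<tau>) *v (K *v \<beta> t w)))" if "w \<in> space M" for t w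
    using loop that by (simp add: delay_free_closed_loop_def matrix_vector_mult_add_rdistrib
        matrix_vector_mul_assoc)
  have L2: "L2_past t (\<beta> t)" for t
  proof (induction t)
    case 0
    show ?case using L2_past_cong[of "\<beta> 0" "\<lambda>_. \<beta>0" 0] init by simp
  next
    case (Suc t)
    have "L2_past (Suc t) (\<lambda>w. (A *v \<beta> t w + L *v (K *v \<beta> t w))
      + (\<Sum>\<tau>\<le>D. \<omega> \<tau> t w *\<^sub>R ((matpow A D ** C \<tau>) *v (K *v \<beta> t w))))"
      by (intro L2_past_add L2_past_sum L2_past_noise L2_past_mono[of t _ "Suc t"] L2_past_matrix Suc)
         simp_all
    then show ?case by (subst L2_past_cong[OF step])
  qed
  have "L2_past t (\<lambda>w. if int t - int j < 0 then 0 else K *v \<beta> (nat (int t - int j)) w)" for t j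
  proof (cases "j \<le> t")
    case True
    then have "nat (int t - int j) \<le> t" by simp
    then show ?thesis using True L2_past_matrix[OF L2_past_mono[OF L2]] by simp
  qed simp
  then show ?thesis
    unfolding reduced_trajectory_def using L2 step by simp
qed

lemma null_process_iff: "(\<And>t. L2_past t (f t)) \<Longrightarrow> mean_square_to_zero M f \<longleftrightarrow> null_process f"
  by (simp add: mean_square_to_zero_def null_process_def L2_past_def)

section \<open>Stabilizability and the Lyapunov inequality\<close>

text \<open>Invertibility of \<open>A\<close> makes every vector reachable as an initial value of the predictor: with zero initial controls
  take \<open>x0 = A^{-D} e_i\<close>. The predictor inherits mean-square decay from the state and, as admissible
  controls have summable second moments, from the controls.\<close>

theorem stabilizable_imp_lyapunov:
  fixes A :: "real^'n^'n" and B C :: "nat \<Rightarrow> real^'m^'n"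
  assumes stab: "ms_stabilizable M D \<omega> A B C" and "invertible A"
    and L: "L = (\<Sum>j\<le>D. matpow A (D - j) ** B j)"
  shows "\<exists>K P. posdef P \<and> posdef (P - lyapunov_rhs D \<sigma> A L C K P)"
proof -
  obtain K0 :: "real^'n^'m" and K where stable: "\<And>x0 u0 x u. initial_data M D x0 u0 x u \<Longrightarrow>
      delayed_system M D \<omega> A B C x u \<Longrightarrow> feedback_law M D K0 K x u \<Longrightarrow>
      admissible M D \<omega> x u \<and> mean_square_to_zero M x"
    using stab unfolding ms_stabilizable_def by blast
  obtain R where R: "matpow A D ** R = mat 1"
    using invertible_matpow[OF \<open>invertible A\<close>, of D] unfolding invertible_def by blast
  have "\<exists>x u. initial_data M D (R *v axis i 1) (\<lambda>_. 0) x u \<and> delayed_system M D \<omega> A B C x u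
      \<and> feedback_law M D K0 K x u" for i
    by (rule closed_loop_exists)
  then obtain x u where init: "\<And>i. initial_data M D (R *v axis i 1) (\<lambda>_. 0) (x i) (u i)"
    and sys: "\<And>i. delayed_system M D \<omega> A B C (x i) (u i)"
    and fb: "\<And>i. feedback_law M D K0 K (x i) (u i)" by metis
  define \<beta> where "\<beta> i = predictor D A B (x i) (u i)" for i
  note L2 = L2_past_closed_loop[OF init sys fb]
  have u_null: "(\<lambda>t. mean_square (u i (int t))) \<longlonglongrightarrow> 0" for i
    using stable[OF init sys fb, of i] by (auto simp: admissible_def intro: summable_LIMSEQ_zero)
  have x_null: "null_process (x i)" for i
    using stable[OF init sys fb, of i] null_process_iff[of "x i"] L2 by blast
  have "null_process (\<beta> i)" for i
    unfolding \<beta>_def predictor_def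
    by (intro null_process_add null_process_sum null_process_matrix x_null null_process_delay u_null)
       (use L2 in \<open>auto simp: Suc_le_eq simp del: of_nat_Suc\<close>)
  then have \<beta>_null: "(\<lambda>t. mean_square (\<beta> i t)) \<longlonglongrightarrow> 0" for i by (simp add: null_process_def)
  have traj: "reduced_trajectory A L (\<lambda>\<tau>. matpow A D ** C \<tau>) (\<lambda>\<tau>. \<tau>) (\<beta> i) (u i)" for i
    unfolding \<beta>_def by (rule reduced_trajectory_predictor[OF init sys fb L])
  have "\<beta> i 0 w = axis i 1" if "w \<in> space M" for i w
    using init[of i] that
    by (simp add: \<beta>_def predictor_def initial_data_def matrix_vector_mul_assoc R)
  from reduced_null_imp_lyapunov[OF traj _ this \<beta>_null u_null] show ?thesis
    unfolding lyapunov_rhs_eq_congr_sum by blast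
qed

theorem delay_free_stabilizable_imp_lyapunov:
  fixes A :: "real^'n^'n" and L :: "real^'m^'n"
  assumes "delay_free_ms_stabilizable M D \<omega> A L C"
  shows "\<exists>K P. posdef P \<and> posdef (P - lyapunov_rhs D \<sigma> A L C K P)"
proof -
  obtain K where stable: "\<And>\<beta>0 \<beta>. \<forall>w\<in>space M. \<beta> 0 w = \<beta>0 \<Longrightarrow>
      delay_free_closed_loop M D \<omega> A L C K \<beta> \<Longrightarrow> mean_square_to_zero M \<beta>"
    using assms unfolding delay_free_ms_stabilizable_def by blast
  define \<beta> :: "'n \<Rightarrow> nat \<Rightarrow> 'w \<Rightarrow> real^'n" where
    "\<beta> i t w = rec_nat (axis i 1) (\<lambda>t b. (A + L ** K) *v b
        + (\<Sum>\<tau>\<le>D. \<omega> \<tau> t w *\<^sub>R ((matpow A D ** C \<tau> ** K) *v b))) t" for i t w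
  have loop: "delay_free_closed_loop M D \<omega> A L C K (\<beta> i)" for i
    by (simp add: delay_free_closed_loop_def \<beta>_def)
  have init: "\<beta> i 0 w = axis i 1" for i w by (simp add: \<beta>_def)
  define u :: "'n \<Rightarrow> int \<Rightarrow> 'w \<Rightarrow> real^'m" where
    "u i = (\<lambda>s w. if s < 0 then 0 else K *v \<beta> i (nat s) w)" for i
  have traj: "reduced_trajectory A L (\<lambda>\<tau>. matpow A D ** C \<tau>) (\<lambda>_. 0) (\<beta> i) (u i)" for i
    unfolding u_def by (rule reduced_trajectory_delay_free[OF init loop])
  have \<beta>_null: "null_process (\<beta> i)" for i
    using stable[OF _ loop, of i] init traj[of i]
    by (subst null_process_iff[symmetric]) (auto simp: reduced_trajectory_def)
  have "(\<lambda>t. mean_square (u i (int t))) \<longlonglongrightarrow> 0" for i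
    using null_process_matrix[OF \<beta>_null, of K] by (simp add: null_process_def u_def)
  moreover have "(\<lambda>t. mean_square (\<beta> i t)) \<longlonglongrightarrow> 0" for i
    using \<beta>_null by (simp add: null_process_def)
  ultimately show ?thesis
    using reduced_null_imp_lyapunov[of A L "\<lambda>\<tau>. matpow A D ** C \<tau>" "\<lambda>_. 0" \<beta> u] traj init
    unfolding lyapunov_rhs_eq_congr_sum by blast
qed

theorem lyapunov_imp_delay_free_stabilizable:
  fixes A :: "real^'n^'n" and L :: "real^'m^'n"
  assumes "posdef P" and "posdef (P - lyapunov_rhs D \<sigma> A L C K P)"
  shows "delay_free_ms_stabilizable M D \<omega> A L C"
  unfolding delay_free_ms_stabilizable_def
proof (intro exI[of _ K] allI impI, elim conjE)
  fix \<beta>0 and \<beta> :: "nat \<Rightarrow> 'w \<Rightarrow> real^'n"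
  assume init: "\<forall>w\<in>space M. \<beta> 0 w = \<beta>0" and loop: "delay_free_closed_loop M D \<omega> A L C K \<beta>"
  have traj: "reduced_trajectory A L (\<lambda>\<tau>. matpow A D ** C \<tau>) (\<lambda>_. 0) \<beta>
      (\<lambda>s w. if s < 0 then 0 else K *v \<beta> (nat s) w)"
    by (rule reduced_trajectory_delay_free[OF bspec[OF init] loop])
  have "summable (\<lambda>t. mean_square (\<beta> t))"
    by (rule summable_reduced_trajectory[OF traj _ _ assms(1) assms(2)[unfolded lyapunov_rhs_eq_congr_sum]])
       simp_all
  then have "null_process \<beta>"
    using traj by (auto simp: null_process_def reduced_trajectory_def intro: summable_LIMSEQ_zero)
  then show "mean_square_to_zero M \<beta>"
    using null_process_iff[of \<beta>] by (simp add: null_process_def)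
qed

text \<open>Feeding the predictor back, \<open>u t = K \<beta> t\<close>, is a law of the required form, because the predictor is a fixed linear
  combination of the state and the last \<open>D\<close> controls. Since \<open>A\<close> is invertible, the state can be recovered from
  the predictor and these controls, and so decays with them.\<close>

theorem lyapunov_imp_stabilizable:
  fixes A :: "real^'n^'n" and B C :: "nat \<Rightarrow> real^'m^'n"
  assumes P: "posdef P" and H: "posdef (P - lyapunov_rhs D \<sigma> A L C K P)"
    and "invertible A" and L: "L = (\<Sum>j\<le>D. matpow A (D - j) ** B j)"
  shows "ms_stabilizable M D \<omega> A B C"
proof -
  define K0 where "K0 = K ** matpow A D"
  define Kd where "Kd \<tau> = K ** predictor_gain D A B (\<tau> - 1)" for \<tau>
  obtain R where R: "R ** matpow A D = mat 1"
    using invertible_matpow[OF \<open>invertible A\<close>, of D] unfolding invertible_def by blast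
  have "admissible M D \<omega> x u \<and> mean_square_to_zero M x"
    if init: "initial_data M D x0 u0 x u" and sys: "delayed_system M D \<omega> A B C x u"
      and fb: "feedback_law M D K0 Kd x u" for x0 u0 x u
  proof -
    define \<beta> where "\<beta> = predictor D A B x u"
    have L2: "L2_past t (x t)" "\<And>j. j \<le> D \<Longrightarrow> L2_past t (u (int t - int j))" for t
      using L2_past_closed_loop[OF init sys fb, of t] by auto
    have u_L2: "L2_past t (u (int t))" for t using L2(2)[of 0 t] by simp
    have feedback: "u (int t) w = K *v \<beta> t w" if "w \<in> space M" for t w
    proof -
      have "(\<Sum>\<tau>=1..D. Kd \<tau> *v u (int t - int \<tau>) w)
          = (\<Sum>i<D. (K ** predictor_gain D A B i) *v u (int t - int (Suc i)) w)"
        by (simp add: sum.atLeast1_atMost_eq Kd_def)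
      then show ?thesis
        using fb that by (simp add: feedback_law_def \<beta>_def predictor_def K0_def matrix_vector_right_distrib
            matrix_vector_mult_sum_right matrix_vector_mul_assoc)
    qed
    have traj: "reduced_trajectory A L (\<lambda>\<tau>. matpow A D ** C \<tau>) (\<lambda>\<tau>. \<tau>) \<beta> u"
      unfolding \<beta>_def by (rule reduced_trajectory_predictor[OF init sys fb L])
    have \<beta>_summable: "summable (\<lambda>t. mean_square (\<beta> t))"
      by (rule summable_reduced_trajectory[OF traj _ feedback P H[unfolded lyapunov_rhs_eq_congr_sum]]) auto
    have \<beta>_L2: "L2_past t (\<beta> t)" for t using traj by (simp add: reduced_trajectory_def)
    have \<beta>_null: "null_process \<beta>"
      using \<beta>_L2 summable_LIMSEQ_zero[OF \<beta>_summable] by (simp add: null_process_def)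
    obtain c where c: "c > 0" "\<And>v. (K *v v) \<bullet> (K *v v) \<le> c * (v \<bullet> v)"
      by (rule matrix_vector_mult_inner_bound[of K]) blast
    have u_le: "mean_square (u (int t)) \<le> c * mean_square (\<beta> t)" for t
    proof -
      have "mean_square (u (int t)) \<le> expectation (\<lambda>w. c * (\<beta> t w \<bullet> \<beta> t w))"
        by (rule integral_mono) (use u_L2[of t] \<beta>_L2[of t] feedback c(2) in \<open>simp_all add: L2_past_def\<close>)
      then show ?thesis by simp
    qed
    have u_summable: "summable (\<lambda>t. mean_square (u (int t)))"
      by (rule summable_comparison_test_ev[OF _ summable_mult[OF \<beta>_summable, of c]])
         (simp add: u_le Bochner_Integration.integral_nonneg)
    have "admissible M D \<omega> x u"
      unfolding admissible_def
    proof (intro conjI allI)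
      show "u (int t) \<in> noise_filtration M D \<omega> t \<rightarrow>\<^sub>M borel" for t
        using L2_past_mono[OF u_L2, of t "Suc t"] by (simp add: L2_past_def past_Suc_eq_noise_filtration)
    qed (use u_L2 u_summable fb in \<open>auto simp: L2_past_def\<close>)
    moreover have "null_process x"
    proof -
      have "null_process (\<lambda>t w. R *v (\<beta> t w
          + (\<Sum>i<D. (- predictor_gain D A B i) *v u (int t - int (Suc i)) w)))"
        by (intro null_process_matrix null_process_add null_process_sum null_process_delay \<beta>_null L2(2)
            summable_LIMSEQ_zero[OF u_summable]) auto
      moreover have "R *v (\<beta> t w + (\<Sum>i<D. (- predictor_gain D A B i) *v u (int t - int (Suc i)) w)) = x t w"
        for t w
      proof -
        have "(- G) *v v = - (G *v v)" for G :: "real^'m^'n" and v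
          using matrix_vector_mult_diff_rdistrib[of 0 G v] by simp
        then show ?thesis by (simp add: \<beta>_def predictor_def sum_negf matrix_vector_mul_assoc R)
      qed
      ultimately show ?thesis by simp
    qed
    ultimately show ?thesis using null_process_iff[of x] L2(1) by simp
  qed
  then show ?thesis unfolding ms_stabilizable_def by blast
qed

end

theorem theorem2:
  fixes M :: "'w measure" and D :: nat
    and \<omega> :: "nat \<Rightarrow> nat \<Rightarrow> 'w \<Rightarrow> real" and \<sigma> :: "nat \<Rightarrow> real"
    and A :: "real^'n^'n" and B C :: "nat \<Rightarrow> real^'m^'n" and L :: "real^'m^'n"
  assumes "delay_noise M D \<omega> \<sigma>"
    and "invertible A"
    and "L = (\<Sum>j\<le>D. matpow A (D - j) ** B j)"
  shows "(ms_stabilizable M D \<omega> A B C \<longleftrightarrow> delay_free_ms_stabilizable M D \<omega> A L C) \<and>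
    (delay_free_ms_stabilizable M D \<omega> A L C \<longleftrightarrow>
      (\<forall>Q. posdef Q \<longrightarrow> (\<exists>K P. posdef P \<and> P = Q + lyapunov_rhs D \<sigma> A L C K P))) \<and>
    ((\<forall>Q. posdef Q \<longrightarrow> (\<exists>K P. posdef P \<and> P = Q + lyapunov_rhs D \<sigma> A L C K P)) \<longleftrightarrow>
      (\<exists>K P. posdef P \<and> posdef (P - lyapunov_rhs D \<sigma> A L C K P)))"
proof -
  interpret delay_noise M D \<omega> \<sigma> by (rule assms(1))
  let ?a = "ms_stabilizable M D \<omega> A B C" and ?b = "delay_free_ms_stabilizable M D \<omega> A L C"
  let ?c = "\<forall>Q. posdef Q \<longrightarrow> (\<exists>K P. posdef P \<and> P = Q + lyapunov_rhs D \<sigma> A L C K P)"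
  let ?d = "\<exists>K P. posdef P \<and> posdef (P - lyapunov_rhs D \<sigma> A L C K P)"
  have "?a \<longleftrightarrow> ?d"
    using stabilizable_imp_lyapunov lyapunov_imp_stabilizable assms(2,3) by blast
  moreover have "?b \<longleftrightarrow> ?d"
    using delay_free_stabilizable_imp_lyapunov lyapunov_imp_delay_free_stabilizable by blast
  moreover have "?c \<longleftrightarrow> ?d"
  proof
    assume ?c
    moreover have "posdef (mat 1 :: real^'n^'n)" by (simp add: posdef_def)
    ultimately obtain K P where "posdef P" and eq: "P = mat 1 + lyapunov_rhs D \<sigma> A L C K P" by blast
    moreover have "P - lyapunov_rhs D \<sigma> A L C K P = mat 1" by (subst (1) eq) simp
    ultimately show ?d using \<open>posdef (mat 1)\<close> by metis
  next
    assume ?d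
    then show ?c unfolding lyapunov_rhs_eq_congr_sum using lyapunov_equation_solvable by blast
  qed
  ultimately show ?thesis by blast
qed

end
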